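(* Let $\mathcal T$ be a self-similar tiling in $\mathbb R^d$ with (single) generator $G\subseteq\mathbb R^d$ of inradius $g$, and suppose a Steiner-like representation $V(G,\varepsilon)=\sum_{k=0}^d\kappa_k(G,\varepsilon)\varepsilon^{d-k}$ ($0<\varepsilon\le g$) has been chosen for $G$. Then for all $\varepsilon\in(0,g)$, $$V(\mathcal T,\varepsilon)=\sum_{\omega\in\mathcal D_{\mathcal T}}\operatorname{Res}_{s=\omega}\zeta_{\mathcal T}(\varepsilon,s)+\lambda_d(G)\,\zeta_{\mathcal L}(d).$$
   Context: Self-similar tilings. Let $\{\Phi_1,\dots,\Phi_N\}$, $N\ge2$, be contractive similarities of $\mathbb R^d$ with scaling ratios $r_n\in(0,1)$, $\Phi(A):=\bigcup_n\Phi_n(A)$, and $F$ the attractor (the unique nonempty compact set with $F=\Phi(F)$). A feasible open set is a nonempty open $O\subseteq\mathbb R^d$ (bounded here) with $\Phi_n(O)\subseteq O$ for all $n$ and $\Phi_n(O)\cap\Phi_m(O)=\emptyset$ for $n\ne m$; the open set condition says that one exists. The nontriviality condition says that $O\not\subseteq\Phi(\overline O)$ for some feasible $O$ (this does not depend on the choice of $O$). Both conditions are always assumed. The self-similar tiling associated with $\{\Phi_n\}$ and $O$ is $\mathcal T=\{\Phi_w(G_q)\}$, where the $G_q$ are the connected components of $O\setminus\Phi(\overline O)$ and $w=w_1\cdots w_n$ runs over all finite words (including the empty word) in $\{1,\dots,N\}$, with $\Phi_w=\Phi_{w_1}\circ\cdots\circ\Phi_{w_n}$, $r_w=r_{w_1}\cdots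 r_{w_n}$ ($\Phi_w=\mathrm{Id}$, $r_w=1$ for the empty word). Here there is a single component $G$ (the generator). The words are ordered as $w^{(1)},w^{(2)},\dots$ so that $\ell_j:=r_{w^{(j)}}$ is nonincreasing; $\mathcal L=\{\ell_j\}$ is the associated fractal string ($\ell_1=1$), and the tiles are $G^j=\Phi_{w^{(j)}}(G)$. Inner parallel volumes. $\lambda_d$ is Lebesgue measure. For bounded open $A\subseteq\mathbb R^d$ and $\varepsilon>0$, $A_{-\varepsilon}:=\{x\in A:\operatorname{dist}(x,A^c)\le\varepsilon\}$, $V(A,\varepsilon):=\lambda_d(A_{-\varepsilon})$, and $V(\mathcal T,\varepsilon):=\lambda_d(T_{-\varepsilon})=\sum_jV(G^j,\varepsilon)$ with $T=\bigcup_jG^j$. The inradius $g$ of $G$ is the radius of the largest open ball contained in $G$. Steiner-like representation. This is an expression $V(G,\varepsilon)=\sum_{k=0}^d\kappa_k(G,\varepsilon)\varepsilon^{d-k}$ for $0<\varepsilon\le g$, where each $\kappa_k(G,\cdot)$ is a real-valued function on $(0,g]$ bounded on $[\varepsilon_0,g]$ for every $\varepsilon_0\in(0,g]$. Put $\kappa_k(G):=\kappa_k(G,g)$ and extend by $\kappa_k(G,\varepsilon):=\kappa_k(G)$ for $\varepsilon\ge g$. Zeta functions. $\zeta_{\mathcal L}(s)=\sum_j\ell_j^s$ for $\Re s$ large, with meromorphic continuation $\zeta_{\mathcal L}(s)=1/(1-\sum_{n=1}^Nr_n^s)$ to $\mathbb C$. The tubular zeta function is (the meromorphic extension in $s$ to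 $\mathbb C$ of) $$\zeta_{\mathcal T}(\varepsilon,s)=\varepsilon^{d-s}\sum_{j=1}^\infty\ell_j^s\left(\sum_{k=0}^d\frac{g^{s-k}}{s-k}\kappa_k(G,\ell_j^{-1}\varepsilon)-\frac{g^{s-d}}{s-d}\lambda_d(G)\right).$$ $\mathcal D_{\mathcal L}$ is the set of poles of $\zeta_{\mathcal L}$ (the complex roots of $\sum_nr_n^s=1$), and $\mathcal D_{\mathcal T}:=\mathcal D_{\mathcal L}\cup\{0,1,\dots,d\}$. Convention. An infinite sum over complex dimensions is understood as $\lim_{n\to\infty}$ of the sums over those $\omega$ with $T_{-n}<\Im\omega<T_n$, where $\{T_n\}_{n\in\mathbb Z}$ is a real sequence with $T_{-n}<0<T_n$ ($n\ge1$), $T_n\to\infty$, $T_{-n}\to-\infty$, $T_n/|T_{-n}|\to1$, along which $\zeta_{\mathcal L}$ is languid of order $0$: for some $c>0$, $|\zeta_{\mathcal L}(\alpha+iT_n)|\le c$ for all $n$ and all $\alpha\in\mathbb R$ (such sequences exist for self-similar strings). *)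

theory Defs
  imports "HOL-Analysis.Analysis" "HOL-Complex_Analysis.Complex_Analysis"
begin

section \<open>Iterated function systems of similarities\<close>

definition contractive_similarity :: "real \<Rightarrow> ('a::euclidean_space \<Rightarrow> 'a) \<Rightarrow> bool" where
  "contractive_similarity r f \<longleftrightarrow> 0 < r \<and> r < 1 \<and> (\<forall>x y. dist (f x) (f y) = r * dist x y)"

definition similarity_ifs ::
  "nat \<Rightarrow> (nat \<Rightarrow> real) \<Rightarrow> (nat \<Rightarrow> 'a::euclidean_space \<Rightarrow> 'a) \<Rightarrow> bool" where
  "similarity_ifs N r \<Phi> \<longleftrightarrow> 2 \<le> N \<and> (\<forall>n\<in>{1..N}. contractive_similarity (r n) (\<Phi> n))"

definition ifs_image ::
  "nat \<Rightarrow> (nat \<Rightarrow> 'a::euclidean_space \<Rightarrow> 'a) \<Rightarrow> 'a set \<Rightarrow> 'a set" where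
  "ifs_image N \<Phi> A = (\<Union>n\<in>{1..N}. \<Phi> n ` A)"

definition feasible_open_set ::
  "nat \<Rightarrow> (nat \<Rightarrow> 'a::euclidean_space \<Rightarrow> 'a) \<Rightarrow> 'a set \<Rightarrow> bool" where
  "feasible_open_set N \<Phi> U \<longleftrightarrow>
     open U \<and> U \<noteq> {} \<and> bounded U \<and>
     (\<forall>n\<in>{1..N}. \<Phi> n ` U \<subseteq> U) \<and>
     (\<forall>n\<in>{1..N}. \<forall>m\<in>{1..N}. n \<noteq> m \<longrightarrow> \<Phi> n ` U \<inter> \<Phi> m ` U = {})"

definition nontriviality_condition ::
  "nat \<Rightarrow> (nat \<Rightarrow> 'a::euclidean_space \<Rightarrow> 'a) \<Rightarrow> bool" where
  "nontriviality_condition N \<Phi> \<longleftrightarrow>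
     (\<exists>U. feasible_open_set N \<Phi> U \<and> \<not> U \<subseteq> ifs_image N \<Phi> (closure U))"

section \<open>Words, generators and the self-similar tiling\<close>

definition ifs_words :: "nat \<Rightarrow> nat list set" where
  "ifs_words N = lists {1..N}"

primrec word_map :: "(nat \<Rightarrow> 'a \<Rightarrow> 'a) \<Rightarrow> nat list \<Rightarrow> 'a \<Rightarrow> 'a" where
  "word_map \<Phi> [] = id"
| "word_map \<Phi> (n # w) = \<Phi> n \<circ> word_map \<Phi> w"

definition word_ratio :: "(nat \<Rightarrow> real) \<Rightarrow> nat list \<Rightarrow> real" where
  "word_ratio r w = prod_list (map r w)"

definition generators ::
  "nat \<Rightarrow> (nat \<Rightarrow> 'a::euclidean_space \<Rightarrow> 'a) \<Rightarrow> 'a set \<Rightarrow> 'a set set" where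
  "generators N \<Phi> U = components (U - ifs_image N \<Phi> (closure U))"

definition self_similar_tiling ::
  "nat \<Rightarrow> (nat \<Rightarrow> 'a::euclidean_space \<Rightarrow> 'a) \<Rightarrow> 'a set \<Rightarrow> 'a set set" where
  "self_similar_tiling N \<Phi> U =
     {word_map \<Phi> w ` G |w G. w \<in> ifs_words N \<and> G \<in> generators N \<Phi> U}"

text \<open>
  Enumeration of all words by nonincreasing ratio. The enumeration starts at index 0, so
  \<open>word_ratio r (w j)\<close> is the \<open>(j+1)\<close>-st length of the associated fractal string.
\<close>
definition word_enumeration :: "nat \<Rightarrow> (nat \<Rightarrow> real) \<Rightarrow> (nat \<Rightarrow> nat list) \<Rightarrow> bool" where
  "word_enumeration N r w \<longleftrightarrow>
     bij_betw w UNIV (ifs_words N) \<and> antimono (\<lambda>j. word_ratio r (w j))"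

section \<open>Inner parallel volumes and Steiner-like representations\<close>

definition inner_parallel_set :: "'a::euclidean_space set \<Rightarrow> real \<Rightarrow> 'a set" where
  "inner_parallel_set A \<epsilon> = {x \<in> A. infdist x (- A) \<le> \<epsilon>}"

definition inner_volume :: "'a::euclidean_space set \<Rightarrow> real \<Rightarrow> real" where
  "inner_volume A \<epsilon> = measure lebesgue (inner_parallel_set A \<epsilon>)"

definition tiling_volume :: "'a::euclidean_space set set \<Rightarrow> real \<Rightarrow> real" where
  "tiling_volume \<T> \<epsilon> = inner_volume (\<Union>\<T>) \<epsilon>"

text \<open>For a nonempty bounded open set the supremum is attained.\<close>
definition inradius :: "'a::euclidean_space set \<Rightarrow> real" where
  "inradius G = Sup {\<rho>. 0 < \<rho> \<and> (\<exists>x. ball x \<rho> \<subseteq> G)}"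

text \<open>Only the values of \<open>\<kappa> k\<close> on \<open>{0<..inradius G}\<close> matter, for \<open>k \<le> DIM('a)\<close>.\<close>
definition steiner_like :: "'a::euclidean_space set \<Rightarrow> (nat \<Rightarrow> real \<Rightarrow> real) \<Rightarrow> bool" where
  "steiner_like G \<kappa> \<longleftrightarrow>
     (\<forall>\<epsilon>\<in>{0<..inradius G}.
        inner_volume G \<epsilon> = (\<Sum>k\<le>DIM('a). \<kappa> k \<epsilon> * \<epsilon> ^ (DIM('a) - k))) \<and>
     (\<forall>k\<le>DIM('a). \<forall>\<epsilon>\<^sub>0\<in>{0<..inradius G}. bounded (\<kappa> k ` {\<epsilon>\<^sub>0..inradius G}))"

definition steiner_ext ::
  "'a::euclidean_space set \<Rightarrow> (nat \<Rightarrow> real \<Rightarrow> real) \<Rightarrow> nat \<Rightarrow> real \<Rightarrow> real" where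
  "steiner_ext G \<kappa> k \<epsilon> = (if \<epsilon> \<le> inradius G then \<kappa> k \<epsilon> else \<kappa> k (inradius G))"

section \<open>Zeta functions and complex dimensions\<close>

text \<open>
  The meromorphic function on the whole plane that agrees with \<open>f\<close> on some right half-plane.
  The requirement \<open>nicely_meromorphic_on\<close> (removable singularities filled in, value 0 at the
  poles) makes it unique as a function.
\<close>
definition meromorphic_continuation :: "(complex \<Rightarrow> complex) \<Rightarrow> complex \<Rightarrow> complex" where
  "meromorphic_continuation f =
     (THE F. F nicely_meromorphic_on UNIV \<and> (\<exists>\<sigma>. \<forall>s. Re s > \<sigma> \<longrightarrow> F s = f s))"

text \<open>Here \<open>L\<close> is a fractal string, i.e. the sequence of its lengths.\<close>
definition string_zeta :: "(nat \<Rightarrow> real) \<Rightarrow> complex \<Rightarrow> complex" where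
  "string_zeta L = meromorphic_continuation (\<lambda>s. \<Sum>j. complex_of_real (L j) powr s)"

definition tubular_zeta ::
  "'a::euclidean_space set \<Rightarrow> (nat \<Rightarrow> real \<Rightarrow> real) \<Rightarrow> (nat \<Rightarrow> real) \<Rightarrow> real \<Rightarrow> complex \<Rightarrow> complex"
  where
  "tubular_zeta G \<kappa> L \<epsilon> = meromorphic_continuation (\<lambda>s.
     complex_of_real \<epsilon> powr (of_nat DIM('a) - s) *
     (\<Sum>j. complex_of_real (L j) powr s *
        ((\<Sum>k\<le>DIM('a). complex_of_real (inradius G) powr (s - of_nat k) / (s - of_nat k) *
             complex_of_real (steiner_ext G \<kappa> k (inverse (L j) * \<epsilon>)))
         - complex_of_real (inradius G) powr (s - of_nat DIM('a)) / (s - of_nat DIM('a)) *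
             complex_of_real (measure lebesgue G))))"

definition string_dimensions :: "(nat \<Rightarrow> real) \<Rightarrow> complex set" where
  "string_dimensions L = {\<omega>. is_pole (string_zeta L) \<omega>}"

definition tiling_dimensions :: "nat \<Rightarrow> (nat \<Rightarrow> real) \<Rightarrow> complex set" where
  "tiling_dimensions d L = string_dimensions L \<union> of_nat ` {..d}"

text \<open>
  Heights of truncation. The bound is required at every point of the horizontal lines, which
  therefore carry no poles, since a pole on a line would make the function unbounded on that line.
\<close>
definition languid_heights :: "(complex \<Rightarrow> complex) \<Rightarrow> (int \<Rightarrow> real) \<Rightarrow> bool" where
  "languid_heights \<zeta> T \<longleftrightarrow>
     (\<forall>n\<ge>1. T (- n) < 0 \<and> 0 < T n) \<and>
     filterlim T at_top at_top \<and>
     filterlim T at_bot at_bot \<and>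
     ((\<lambda>n. T n / \<bar>T (- n)\<bar>) \<longlongrightarrow> 1) at_top \<and>
     (\<exists>c>0. \<forall>n \<alpha>. norm (\<zeta> (Complex \<alpha> (T n))) \<le> c)"

definition truncated_residue_sum ::
  "(int \<Rightarrow> real) \<Rightarrow> complex set \<Rightarrow> (complex \<Rightarrow> complex) \<Rightarrow> nat \<Rightarrow> complex" where
  "truncated_residue_sum T D f n =
     (\<Sum>\<omega>\<in>{\<omega> \<in> D. T (- int n) < Im \<omega> \<and> Im \<omega> < T (int n)}. residue f \<omega>)"

end

theory Submission
  imports Defs
begin

text \<open>
  Write \<open>\<ell> j\<close> for the ratios of the words, \<open>g\<close> for the inradius and \<open>\<lambda>(G)\<close> for the volume of the generator,
  \<open>x = g / \<epsilon> > 1\<close>, and \<open>\<zeta>(s) = 1 / (1 - p(s))\<close> with \<open>p(s) = \<Sum>n r\<^sub>n\<^sup>s\<close>. The tiles are disjoint open sets, so the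
  volume is \<open>\<Sum>j \<ell> j ^ d * V(G, \<epsilon> / \<ell> j)\<close> (lemma \<open>tiling_volume_sums\<close>; the scaling of Lebesgue measure under
  similarities is \<open>emeasure_similarity_image\<close>). A tile with \<open>\<ell> j * x \<le> 1\<close> has inradius at most \<open>\<epsilon>\<close> and
  contributes its full volume. Let \<open>J\<close> be the finite set of the other indices. Comparing volumes in the
  feasible open set gives \<open>p(d) < 1\<close> (\<open>sum_ratio_power_less_one\<close>), so the tiling volume is \<open>\<lambda>(G) \<zeta>(d)\<close> plus the sum over \<open>J\<close> of \<open>\<ell> j ^ d * (V(G, \<epsilon> / \<ell> j) - \<lambda>(G))\<close>.

  The extended coefficients \<open>\<kappa> k (\<epsilon> / \<ell> j)\<close> do not depend on \<open>j\<close> outside \<open>J\<close>. Splitting off the terms in \<open>J\<close> (lemma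
  \<open>tubular_zeta_eq\<close>) writes the tubular zeta function as \<open>\<epsilon> ^ d\<close> times the sum of two functions. The first is
  \<open>E(s) = R(s) x\<^sup>s H(s)\<close>, where \<open>R(s) = \<zeta>(s) - \<Sum>j\<in>J. \<ell> j\<^sup>s\<close> and \<open>H(s) = \<Sum>k a\<^sub>k / (s - k)\<close>; the second is a finite sum
  of terms \<open>b * (\<ell> j * x)\<^sup>s / (s - k)\<close> with \<open>j \<in> J\<close> and \<open>0 \<le> k \<le> d\<close>. By the Steiner-like representation, the residues of the
  second part at \<open>0, \<dots>, d\<close>, times \<open>\<epsilon> ^ d\<close>, add up exactly to the sum over \<open>J\<close> above, so it remains to show that the residue
  sums of \<open>E\<close> tend to 0.

  Because the inner parallel volume at \<open>\<epsilon> = g\<close> is all of \<open>\<lambda>(G)\<close>, the coefficients satisfy \<open>\<Sum>k a\<^sub>k = 0\<close>, hence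
  \<open>H(s)\<close> decays quadratically (\<open>sum_simple_poles_decay\<close>). The factor \<open>R(s) x\<^sup>s\<close> is bounded (\<open>zeta_remainder_bounded\<close>):
  to the right because there it is the sum over \<open>j \<notin> J\<close> of \<open>(\<ell> j * x)\<^sup>s\<close> with \<open>\<ell> j * x \<le> 1\<close>, to the left because
  the smallest ratio dominates \<open>p(s)\<close> and \<open>x > 1\<close>, and on the horizontal lines by languidity. By the
  residue theorem, the residue sum of \<open>E\<close> is an integral over a rectangle whose side lengths and whose distance from
  the origin are of the same order, so it tends to 0 (\<open>residue_sum_window_tendsto_0\<close>).
\<close>

section \<open>Similarities and Lebesgue measure\<close>

lemma similarity_bij:
  fixes f :: "'a::euclidean_space \<Rightarrow> 'a"
  assumes "0 < r" and f: "\<And>x y. dist (f x) (f y) = r * dist x y"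
  shows "bij f"
proof -
  have inj: "inj f"
    by (rule injI) (use f \<open>0 < r\<close> in \<open>metis dist_eq_0_iff less_irrefl mult_eq_0_iff\<close>)
  have "linear (\<lambda>x. f x - f 0)"
    by (rule scaling_linear[where c = r]) (use f in \<open>auto simp: dist_norm\<close>)
  moreover have "inj (\<lambda>x. f x - f 0)"
    using inj by (auto simp: inj_def)
  ultimately have "surj (\<lambda>x. f x - f 0)"
    by (rule linear_inj_imp_surj)
  hence "surj f"
    unfolding surj_def by (metis add_diff_cancel_right' diff_add_cancel)
  with inj show ?thesis by (simp add: bij_def)
qed

lemma similarity_image_ball:
  fixes f :: "'a::euclidean_space \<Rightarrow> 'a"
  assumes "0 < r" and f: "\<And>x y. dist (f x) (f y) = r * dist x y"
  shows "f ` ball a \<rho> = ball (f a) (r * \<rho>)"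
proof
  show "f ` ball a \<rho> \<subseteq> ball (f a) (r * \<rho>)"
    using assms by auto
  show "ball (f a) (r * \<rho>) \<subseteq> f ` ball a \<rho>"
  proof
    fix y assume y: "y \<in> ball (f a) (r * \<rho>)"
    obtain x where "y = f x" using similarity_bij[OF assms] by (metis bij_pointE)
    with y show "y \<in> f ` ball a \<rho>" using assms by auto
  qed
qed

lemma similarity_open_image:
  fixes f :: "'a::euclidean_space \<Rightarrow> 'a"
  assumes "0 < r" and "\<And>x y. dist (f x) (f y) = r * dist x y" and "open S"
  shows "open (f ` S)"
  unfolding open_contains_ball
proof
  fix y assume "y \<in> f ` S"
  then obtain x where x: "x \<in> S" "y = f x" by auto
  obtain e where "e > 0" "ball x e \<subseteq> S" using \<open>open S\<close> x(1) by (meson openE)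
  hence "ball y (r * e) \<subseteq> f ` S" "r * e > 0"
    using similarity_image_ball[OF assms(1,2), of x e] x(2) \<open>0 < r\<close> image_mono[of "ball x e" S f]
    by simp_all
  thus "\<exists>e>0. ball y e \<subseteq> f ` S" by blast
qed

text \<open>
  A similarity with ratio \<open>r\<close> multiplies the measure of an open set by \<open>r ^ d\<close>. By Vitali's
  covering theorem an open set is, up to a null set, a disjoint union of balls, for which the
  claim is clear.
\<close>
lemma emeasure_similarity_image:
  fixes f :: "'a::euclidean_space \<Rightarrow> 'a"
  assumes "0 < r" and f: "\<And>x y. dist (f x) (f y) = r * dist x y" and "open S"
  shows "emeasure lebesgue (f ` S) = ennreal (r ^ DIM('a)) * emeasure lebesgue S"
proof -
  let ?K = "{(a, \<rho>). 0 < \<rho> \<and> ball a \<rho> \<subseteq> S}"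
  have inj: "inj f" using similarity_bij[OF assms(1,2)] by (simp add: bij_def)
  obtain C where C: "countable C" "C \<subseteq> ?K"
    "pairwise (\<lambda>i j. disjnt (ball (fst i) (snd i)) (ball (fst j) (snd j))) C"
    "negligible (S - (\<Union>i\<in>C. ball (fst i) (snd i)))"
  proof (rule Vitali_covering_theorem_balls[of S ?K fst snd])
    fix x and d :: real assume "x \<in> S" "0 < d"
    then obtain e where "e > 0" "ball x e \<subseteq> S" using \<open>open S\<close> by (meson openE)
    thus "\<exists>i. i \<in> ?K \<and> x \<in> ball (fst i) (snd i) \<and> snd i < d"
      using \<open>0 < d\<close> by (intro exI[of _ "(x, min e (d/2))"]) (auto simp: subset_iff)
  qed blast
  let ?B = "\<Union>i\<in>C. ball (fst i) (snd i)"
  let ?fB = "\<Union>i\<in>C. ball (f (fst i)) (r * snd i)"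
  have disj: "disjoint_family_on (\<lambda>i. ball (fst i) (snd i)) C"
    using C(3) by (auto simp: disjoint_family_on_def pairwise_def disjnt_def)
  have fball: "f ` ball a \<rho> = ball (f a) (r * \<rho>)" for a \<rho>
    by (rule similarity_image_ball[OF assms(1,2)])
  have disj': "disjoint_family_on (\<lambda>i. ball (f (fst i)) (r * snd i)) C"
    using C(3) by (auto simp: disjoint_family_on_def pairwise_def disjnt_def
        fball[symmetric] image_Int[OF inj, symmetric] simp del: ball_eq_empty)
  have BS: "?B \<subseteq> S" using C(2) by (fastforce simp del: mem_ball)
  have fBS: "?fB \<subseteq> f ` S" using image_mono[OF BS, of f] by (simp add: fball[symmetric] image_UN)
  have eq: "f ` S - ?fB = f ` (S - ?B)"
    by (simp add: fball[symmetric] image_set_diff[OF inj] image_UN)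
  have neg: "negligible (f ` (S - ?B))"
    by (rule negligible_locally_Lipschitz_image[OF _ C(4)])
       (use f in \<open>auto simp: dist_norm[symmetric] intro!: exI[of _ UNIV] exI[of _ r]\<close>)
  have e1: "emeasure lebesgue S = emeasure lebesgue ?B"
  proof -
    have "emeasure lebesgue (?B \<union> (S - ?B)) = emeasure lebesgue ?B"
      by (rule emeasure_Un_null_set)
         (use C(1,4) in \<open>auto simp: negligible_iff_null_sets intro!: sets.countable_UN'\<close>)
    thus ?thesis using BS by (simp add: Un_absorb1)
  qed
  have e2: "emeasure lebesgue (f ` S) = emeasure lebesgue ?fB"
  proof -
    have "emeasure lebesgue (?fB \<union> f ` (S - ?B)) = emeasure lebesgue ?fB"
      by (rule emeasure_Un_null_set)
         (use C(1) neg in \<open>auto simp: negligible_iff_null_sets intro!: sets.countable_UN'\<close>)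
    moreover have "?fB \<union> f ` (S - ?B) = f ` S" using fBS eq by auto
    ultimately show ?thesis by simp
  qed
  have "emeasure lebesgue ?fB = (\<integral>\<^sup>+i. emeasure lebesgue (ball (f (fst i)) (r * snd i)) \<partial>count_space C)"
    by (rule emeasure_UN_countable) (use disj' C(1) in auto)
  also have "\<dots> = (\<integral>\<^sup>+i. ennreal (r ^ DIM('a)) * emeasure lebesgue (ball (fst i) (snd i)) \<partial>count_space C)"
  proof (rule nn_integral_cong)
    fix i assume "i \<in> space (count_space C)"
    hence "snd i \<ge> 0" using C(2) by auto
    thus "emeasure lebesgue (ball (f (fst i)) (r * snd i)) =
          ennreal (r ^ DIM('a)) * emeasure lebesgue (ball (fst i) (snd i))"
      using \<open>0 < r\<close> emeasure_lebesgue_ball_conv_unit_ball[of "r * snd i" "f (fst i)"]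
        emeasure_lebesgue_ball_conv_unit_ball[of "snd i" "fst i"]
      by (simp add: power_mult_distrib ennreal_mult mult.assoc)
  qed
  also have "\<dots> = ennreal (r ^ DIM('a)) * (\<integral>\<^sup>+i. emeasure lebesgue (ball (fst i) (snd i)) \<partial>count_space C)"
    by (rule nn_integral_cmult) auto
  also have "(\<integral>\<^sup>+i. emeasure lebesgue (ball (fst i) (snd i)) \<partial>count_space C) = emeasure lebesgue ?B"
    by (rule emeasure_UN_countable[symmetric]) (use disj C(1) in auto)
  finally show ?thesis using e1 e2 by simp
qed

corollary measure_similarity_image:
  fixes f :: "'a::euclidean_space \<Rightarrow> 'a"
  assumes "0 < r" and "\<And>x y. dist (f x) (f y) = r * dist x y" and "open S"
  shows "measure lebesgue (f ` S) = r ^ DIM('a) * measure lebesgue S"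
  using emeasure_similarity_image[OF assms] \<open>0 < r\<close>
  by (simp add: measure_def enn2real_mult)

lemma infdist_similarity_image:
  fixes f :: "'a::euclidean_space \<Rightarrow> 'a"
  assumes "0 < r" and f: "\<And>x y. dist (f x) (f y) = r * dist x y"
  shows "infdist (f x) (f ` A) = r * infdist x A"
proof (cases "A = {}")
  case False
  have "infdist (f x) (f ` A) \<ge> r * infdist x A"
    using False f \<open>0 < r\<close> by (auto simp: infdist_notempty[of "f ` A"] intro!: cINF_greatest infdist_le)
  moreover have "infdist x A \<ge> infdist (f x) (f ` A) / r"
    unfolding infdist_notempty[OF False] using False
  proof (rule cINF_greatest)
    fix y assume "y \<in> A"
    hence "infdist (f x) (f ` A) \<le> dist (f x) (f y)" by (intro infdist_le) auto
    thus "infdist (f x) (f ` A) / r \<le> dist x y" using f \<open>0 < r\<close> by (simp add: field_simps)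
  qed
  ultimately show ?thesis using \<open>0 < r\<close> by (simp add: field_simps)
qed (simp add: infdist_def)

section \<open>Inner parallel sets\<close>

lemma open_infdist_gt: "open {x \<in> A. infdist x B > \<epsilon>}" if "open A"
proof -
  have "open {x. infdist x B > \<epsilon>}"
    by (intro open_Collect_less continuous_intros)
  with that have "open (A \<inter> {x. infdist x B > \<epsilon>})" by blast
  thus ?thesis by (simp add: Collect_conj_eq)
qed

lemma sets_inner_parallel_set [intro]: "inner_parallel_set A \<epsilon> \<in> sets lebesgue" if "open A"
proof -
  have "inner_parallel_set A \<epsilon> = A - {x \<in> A. infdist x (- A) > \<epsilon>}"
    by (auto simp: inner_parallel_set_def)
  thus ?thesis using that open_infdist_gt[OF that, of \<epsilon> "- A"] by (simp add: borel_open sets.Diff)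
qed

lemma inner_volume_eq_Diff:
  fixes A :: "'a::euclidean_space set"
  assumes "open A" "bounded A"
  shows "inner_volume A \<epsilon> = measure lebesgue A - measure lebesgue {x \<in> A. infdist x (- A) > \<epsilon>}"
proof -
  have eq: "inner_parallel_set A \<epsilon> = A - {x \<in> A. infdist x (- A) > \<epsilon>}"
    by (auto simp: inner_parallel_set_def)
  have "open {x \<in> A. infdist x (- A) > \<epsilon>}" by (rule open_infdist_gt) fact
  moreover have "bounded {x \<in> A. infdist x (- A) > \<epsilon>}"
    using assms(2) by (rule bounded_subset) auto
  ultimately have "{x \<in> A. infdist x (- A) > \<epsilon>} \<in> lmeasurable"
    by (intro lmeasurable_open)
  moreover have "A \<in> lmeasurable" using assms by (intro lmeasurable_open)
  ultimately show ?thesis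
    unfolding inner_volume_def eq by (intro measurable_measure_Diff fmeasurableD) auto
qed

lemma inner_volume_similarity:
  fixes f :: "'a::euclidean_space \<Rightarrow> 'a"
  assumes "0 < r" and f: "\<And>x y. dist (f x) (f y) = r * dist x y" and "open A" "bounded A"
  shows "inner_volume (f ` A) \<epsilon> = r ^ DIM('a) * inner_volume A (\<epsilon> / r)"
proof -
  note sim = measure_similarity_image[OF assms(1,2)]
  have bdd: "bounded (f ` A)"
  proof -
    obtain a e where "A \<subseteq> ball a e" using \<open>bounded A\<close> by (meson bounded_subset_ballD)
    hence "f ` A \<subseteq> ball (f a) (r * e)" using similarity_image_ball[OF assms(1,2), of a e] by auto
    thus ?thesis using bounded_ball bounded_subset by blast
  qed
  have "- (f ` A) = f ` (- A)"
    using similarity_bij[OF assms(1,2)] by (simp add: bij_image_Compl_eq)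
  hence "{x \<in> f ` A. infdist x (- f ` A) > \<epsilon>} = f ` {x \<in> A. infdist x (- A) > \<epsilon> / r}"
    using \<open>0 < r\<close> by (auto simp: infdist_similarity_image[OF assms(1,2)] field_simps)
  thus ?thesis
    using assms bdd sim[OF \<open>open A\<close>] sim[OF open_infdist_gt[OF \<open>open A\<close>, of "\<epsilon> / r" "- A"]]
    by (simp add: inner_volume_eq_Diff similarity_open_image[OF assms(1,2)] algebra_simps)
qed

text \<open>Beyond the inradius the inner parallel set is everything.\<close>
lemma inner_volume_ge_inradius:
  fixes G :: "'a::euclidean_space set"
  assumes "open G" "bounded G" "inradius G \<le> \<epsilon>"
  shows "inner_volume G \<epsilon> = measure lebesgue G"
proof -
  let ?R = "{\<rho>. 0 < \<rho> \<and> (\<exists>x. ball x \<rho> \<subseteq> G)}"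
  have bdd: "bdd_above ?R"
  proof -
    obtain B where B: "\<And>x y. x \<in> G \<Longrightarrow> y \<in> G \<Longrightarrow> dist x y \<le> B"
      using \<open>bounded G\<close> unfolding bounded_two_points by auto
    have "\<rho> \<le> 2 * B" if "0 < \<rho>" "ball x \<rho> \<subseteq> G" for \<rho> x
    proof -
      obtain b :: 'a where b: "b \<in> Basis" using nonempty_Basis by blast
      have "x + (\<rho>/2) *\<^sub>R b \<in> ball x \<rho>" using that b by (simp add: dist_norm)
      hence "dist x (x + (\<rho>/2) *\<^sub>R b) \<le> B" using that by (intro B) auto
      thus ?thesis using that b by (simp add: dist_norm)
    qed
    thus ?thesis by (auto simp: bdd_above_def)
  qed
  have "infdist x (- G) \<le> \<epsilon>" if "x \<in> G" for x
  proof (cases "infdist x (- G) > 0")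
    case True
    have "ball x (infdist x (- G)) \<subseteq> G"
      using infdist_le[of _ "- G" x] by (force simp: dist_commute)
    hence "infdist x (- G) \<in> ?R" using True by blast
    hence "infdist x (- G) \<le> inradius G"
      unfolding inradius_def by (rule cSup_upper[OF _ bdd])
    with assms show ?thesis by simp
  next
    case False
    obtain e where e: "e > 0" "ball x e \<subseteq> G" using \<open>open G\<close> \<open>x \<in> G\<close> by (meson openE)
    hence "e \<le> inradius G" unfolding inradius_def by (intro cSup_upper[OF _ bdd]) auto
    with False e assms show ?thesis by simp
  qed
  hence "inner_parallel_set G \<epsilon> = G" by (auto simp: inner_parallel_set_def)
  thus ?thesis by (simp add: inner_volume_def)
qed

text \<open>
  The ball around \<open>x\<close> up to the complement of the union is connected, so it stays in the one set
  that contains \<open>x\<close>.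
\<close>
lemma inner_parallel_set_disjoint_Union:
  fixes A :: "'i \<Rightarrow> 'a::euclidean_space set"
  assumes "\<And>i. open (A i)" and disj: "disjoint_family A" and "(\<Union>i. A i) \<noteq> UNIV"
  shows "inner_parallel_set (\<Union>i. A i) \<epsilon> = (\<Union>i. inner_parallel_set (A i) \<epsilon>)"
proof -
  have "infdist x (- (\<Union>i. A i)) = infdist x (- A i)" if x: "x \<in> A i" for x i
  proof (rule antisym)
    have ne: "- (\<Union>i. A i) \<noteq> {}" using assms(3) by blast
    show "infdist x (- A i) \<le> infdist x (- (\<Union>i. A i))"
      by (rule infdist_mono[OF _ ne]) auto
    let ?\<rho> = "infdist x (- (\<Union>i. A i))"
    have ne': "- A i \<noteq> {}" using ne by auto
    show "?\<rho> \<le> infdist x (- A i)"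
      unfolding infdist_notempty[OF ne'] using ne'
    proof (rule cINF_greatest)
      fix y assume y: "y \<in> - A i"
      show "?\<rho> \<le> dist x y"
      proof (rule ccontr)
        assume "\<not> ?\<rho> \<le> dist x y"
        hence y': "y \<in> ball x ?\<rho>" by simp
        let ?V = "\<Union>j\<in>-{i}. A j"
        have sub: "ball x ?\<rho> \<subseteq> A i \<union> ?V"
          using infdist_le[of _ "- (\<Union>i. A i)" x] by (force simp: dist_commute)
        have "connected (ball x ?\<rho>)" by simp
        moreover have "open (A i)" "open ?V" using assms(1) by auto
        moreover have "A i \<inter> ?V \<inter> ball x ?\<rho> = {}"
          using disj by (auto simp: disjoint_family_on_def)
        moreover have "x \<in> ball x ?\<rho>" using y' by (simp add: order.strict_trans1[OF zero_le_dist])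
        hence "A i \<inter> ball x ?\<rho> \<noteq> {}" using x by blast
        moreover have "?V \<inter> ball x ?\<rho> \<noteq> {}" using y y' sub by blast
        ultimately show False using sub by (meson connectedD)
      qed
    qed
  qed
  thus ?thesis by (auto simp: inner_parallel_set_def)
qed

lemma inner_volume_disjoint_Union_sums:
  fixes A :: "nat \<Rightarrow> 'a::euclidean_space set"
  assumes op: "\<And>i. open (A i)" and disj: "disjoint_family A" and bdd: "bounded (\<Union>i. A i)"
  shows "(\<lambda>i. inner_volume (A i) \<epsilon>) sums inner_volume (\<Union>i. A i) \<epsilon>"
proof -
  have "(\<Union>i. A i) \<noteq> UNIV" using bdd by auto
  hence eq: "inner_parallel_set (\<Union>i. A i) \<epsilon> = (\<Union>i. inner_parallel_set (A i) \<epsilon>)"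
    by (intro inner_parallel_set_disjoint_Union op disj)
  have "emeasure lebesgue (\<Union>i. inner_parallel_set (A i) \<epsilon>) \<le> emeasure lebesgue (\<Union>i. A i)"
    using op by (intro emeasure_mono) (auto simp: inner_parallel_set_def intro!: borel_open)
  also have "\<dots> < \<infinity>"
    using lmeasurable_open[OF bdd] op by (auto simp: fmeasurable_def)
  finally have fin: "emeasure lebesgue (\<Union>i. inner_parallel_set (A i) \<epsilon>) < \<infinity>" .
  have "disjoint_family (\<lambda>i. inner_parallel_set (A i) \<epsilon>)"
    using disj by (fastforce simp: disjoint_family_on_def inner_parallel_set_def)
  with fin have "(\<lambda>i. measure lebesgue (inner_parallel_set (A i) \<epsilon>)) sums
      measure lebesgue (\<Union>i. inner_parallel_set (A i) \<epsilon>)"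
    using op by (intro measure_UNION) auto
  thus ?thesis by (simp add: inner_volume_def eq)
qed

section \<open>Geometry of the tiles\<close>

lemma similarity_ifsD:
  assumes "similarity_ifs N r \<Phi>" "n \<in> {1..N}"
  shows "0 < r n" "r n < 1" "dist (\<Phi> n x) (\<Phi> n y) = r n * dist x y"
  using assms by (auto simp: similarity_ifs_def contractive_similarity_def)

lemma ifs_words_Cons: "n # v \<in> ifs_words N \<longleftrightarrow> n \<in> {1..N} \<and> v \<in> ifs_words N"
  by (auto simp: ifs_words_def)

lemma word_ratio_pos:
  assumes "\<And>n. n \<in> {1..N} \<Longrightarrow> 0 < r n" "v \<in> ifs_words N"
  shows "0 < word_ratio r v"
  using assms(2)
proof (induction v)
  case (Cons n v)
  thus ?case using assms(1)[of n] by (simp add: word_ratio_def ifs_words_Cons)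
qed (simp add: word_ratio_def)

lemma dist_word_map:
  assumes "similarity_ifs N r \<Phi>" "v \<in> ifs_words N"
  shows "dist (word_map \<Phi> v x) (word_map \<Phi> v y) = word_ratio r v * dist x y"
  using assms(2)
proof (induction v)
  case (Cons n v)
  thus ?case using similarity_ifsD(3)[OF assms(1), of n]
    by (simp add: word_ratio_def ifs_words_Cons)
qed (simp add: word_ratio_def)

lemma word_map_image_subset:
  assumes "feasible_open_set N \<Phi> U" "v \<in> ifs_words N"
  shows "word_map \<Phi> v ` U \<subseteq> U"
  using assms(2)
proof (induction v)
  case (Cons n v)
  hence "word_map \<Phi> v ` U \<subseteq> U" "\<Phi> n ` U \<subseteq> U"
    using assms(1) by (auto simp: feasible_open_set_def ifs_words_Cons)
  thus ?case by fastforce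
qed simp

text \<open>
  If two words differ at some letter, the tiles lie in disjoint images of \<open>U\<close>. If one word properly
  extends the other, then, relative to the shorter word, its tile lies in the image of \<open>U\<close> under
  the system, which the generator avoids.
\<close>
lemma disjoint_tiles:
  assumes ifs: "similarity_ifs N r \<Phi>" and feas: "feasible_open_set N \<Phi> U"
    and G: "G \<subseteq> U - ifs_image N \<Phi> U"
    and "u \<in> ifs_words N" "v \<in> ifs_words N" "u \<noteq> v"
  shows "word_map \<Phi> u ` G \<inter> word_map \<Phi> v ` G = {}"
proof -
  have sub: "word_map \<Phi> (n # v) ` G \<subseteq> \<Phi> n ` U" if "n # v \<in> ifs_words N" for n v
  proof -
    have "word_map \<Phi> v ` G \<subseteq> U"
      using word_map_image_subset[OF feas, of v] that G by (auto simp: ifs_words_Cons)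
    thus ?thesis by (auto simp: image_subset_iff)
  qed
  have nil: "word_map \<Phi> [] ` G \<inter> word_map \<Phi> (n # v) ` G = {}" if "n # v \<in> ifs_words N" for n v
  proof -
    have "n \<in> {1..N}" using that by (simp add: ifs_words_Cons)
    hence "\<Phi> n ` U \<subseteq> ifs_image N \<Phi> U" by (auto simp: ifs_image_def)
    hence "G \<inter> \<Phi> n ` U = {}" using G by blast
    hence "G \<inter> word_map \<Phi> (n # v) ` G = {}" using sub[OF that] by blast
    thus ?thesis by (simp only: word_map.simps image_id id_apply)
  qed
  show ?thesis using assms(4-6)
  proof (induction u arbitrary: v)
    case Nil
    then obtain n v' where "v = n # v'" by (cases v) auto
    with nil[of n v'] Nil show ?case by (simp only: simp_thms)
  next
    case (Cons m u)
    show ?case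
    proof (cases v)
      case Nil
      with nil[of m u] Cons(2) show ?thesis by (simp only: Int_commute)
    next
      case v: (Cons n v')
      show ?thesis
      proof (cases "m = n")
        case False
        hence "\<Phi> m ` U \<inter> \<Phi> n ` U = {}"
          using feas Cons v by (auto simp: feasible_open_set_def ifs_words_Cons)
        thus ?thesis using sub[of m u] sub[of n v'] Cons(2,3) unfolding v by blast
      next
        case True
        have "inj (\<Phi> n)"
          using similarity_bij[of "r n" "\<Phi> n"] similarity_ifsD[OF ifs, of n] Cons v
          by (auto simp: bij_def ifs_words_Cons)
        moreover have "word_map \<Phi> u ` G \<inter> word_map \<Phi> v' ` G = {}"
          using Cons v True by (auto simp: ifs_words_Cons)
        ultimately show ?thesis
          by (simp only: v True word_map.simps image_comp[symmetric] image_Int[symmetric] image_empty)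
      qed
    qed
  qed
qed

lemma generator_properties:
  fixes U G :: "'a::euclidean_space set"
  assumes ifs: "similarity_ifs N r \<Phi>" and feas: "feasible_open_set N \<Phi> U"
    and "G \<in> generators N \<Phi> U"
  shows "open G" "bounded G" "G \<noteq> {}" "G \<subseteq> U - ifs_image N \<Phi> U"
proof -
  have U: "open U" "bounded U" using feas by (auto simp: feasible_open_set_def)
  have "compact (\<Phi> n ` closure U)" if "n \<in> {1..N}" for n
  proof (rule compact_continuous_image)
    have "(r n)-lipschitz_on (closure U) (\<Phi> n)"
      using similarity_ifsD[OF ifs that] by (intro lipschitz_onI) (auto intro: less_imp_le)
    thus "continuous_on (closure U) (\<Phi> n)" by (rule lipschitz_on_continuous_on)
  qed (use U in simp)
  hence "closed (ifs_image N \<Phi> (closure U))"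
    unfolding ifs_image_def by (auto intro!: closed_UN compact_imp_closed)
  hence "open (U - ifs_image N \<Phi> (closure U))" using U by auto
  thus "open G" using assms(3) open_components by (auto simp: generators_def)
  show "G \<noteq> {}" using assms(3) in_components_nonempty by (auto simp: generators_def)
  have "G \<subseteq> U - ifs_image N \<Phi> (closure U)"
    using assms(3) in_components_subset by (auto simp: generators_def)
  moreover have "ifs_image N \<Phi> U \<subseteq> ifs_image N \<Phi> (closure U)"
    unfolding ifs_image_def using closure_subset[of U] by blast
  ultimately show "G \<subseteq> U - ifs_image N \<Phi> U" by blast
  thus "bounded G" using U(2) bounded_subset by blast
qed

text \<open>
  The images of \<open>U\<close> and the generator are disjoint in \<open>U\<close>, so the similarity dimension is less
  than the dimension of the space.
\<close>
lemma sum_ratio_power_less_one: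
  fixes U G :: "'a::euclidean_space set"
  assumes ifs: "similarity_ifs N r \<Phi>" and feas: "feasible_open_set N \<Phi> U"
    and G: "open G" "G \<noteq> {}" "G \<subseteq> U - ifs_image N \<Phi> U"
  shows "(\<Sum>n=1..N. r n ^ DIM('a)) < 1"
proof -
  have U: "open U" "bounded U" using feas by (auto simp: feasible_open_set_def)
  have sub: "\<Phi> n ` U \<subseteq> U" if "n \<in> {1..N}" for n
    using feas that by (auto simp: feasible_open_set_def)
  have lmU: "U \<in> lmeasurable" using U by (intro lmeasurable_open)
  have op: "open (\<Phi> n ` U)" if "n \<in> {1..N}" for n
    using similarity_ifsD[OF ifs that] U by (intro similarity_open_image) auto
  have lm: "\<Phi> n ` U \<in> lmeasurable" if "n \<in> {1..N}" for n
    using op[OF that] sub[OF that] U by (intro lmeasurable_open) (auto intro: bounded_subset)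
  have lmG: "G \<in> lmeasurable"
    using G U by (intro lmeasurable_open) (auto intro: bounded_subset)
  have lmI: "ifs_image N \<Phi> U \<in> lmeasurable"
    unfolding ifs_image_def using lm by (intro fmeasurable.finite_UN) auto
  have "measure lebesgue (ifs_image N \<Phi> U) = (\<Sum>n=1..N. measure lebesgue (\<Phi> n ` U))"
    unfolding ifs_image_def
  proof (rule measure_UNION')
    show "pairwise (\<lambda>i j. disjnt (\<Phi> i ` U) (\<Phi> j ` U)) {1..N}"
      using feas unfolding feasible_open_set_def pairwise_def disjnt_def by blast
  qed (use lm in auto)
  also have "\<dots> = (\<Sum>n=1..N. r n ^ DIM('a) * measure lebesgue U)"
    using similarity_ifsD[OF ifs] U by (intro sum.cong refl measure_similarity_image) auto
  finally have I: "measure lebesgue (ifs_image N \<Phi> U) = (\<Sum>n=1..N. r n ^ DIM('a)) * measure lebesgue U"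
    by (simp add: sum_distrib_right)
  have "measure lebesgue (ifs_image N \<Phi> U \<union> G) = measure lebesgue (ifs_image N \<Phi> U) + measure lebesgue G"
  proof -
    have "G - ifs_image N \<Phi> U = G" using G by auto
    thus ?thesis using measure_Un2[OF lmI lmG] by simp
  qed
  moreover have "measure lebesgue (ifs_image N \<Phi> U \<union> G) \<le> measure lebesgue U"
  proof (rule measure_mono_fmeasurable)
    show "ifs_image N \<Phi> U \<union> G \<subseteq> U" using sub G unfolding ifs_image_def by blast
  qed (use lmI lmG lmU in auto)
  moreover have posG: "0 < measure lebesgue G"
  proof -
    have "\<not> negligible G" using G open_not_negligible by blast
    thus ?thesis using lmG negligible_iff_measure[of G] by (simp add: zero_less_measure_iff)
  qed
  ultimately have "(\<Sum>n=1..N. r n ^ DIM('a)) * measure lebesgue U < 1 * measure lebesgue U"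
    by (simp add: I)
  thus ?thesis by (rule mult_right_less_imp_less) simp
qed

lemma tiling_volume_sums:
  fixes U G :: "'a::euclidean_space set"
  assumes ifs: "similarity_ifs N r \<Phi>" and feas: "feasible_open_set N \<Phi> U"
    and gen: "generators N \<Phi> U = {G}" and w: "bij_betw w UNIV (ifs_words N)"
  shows "(\<lambda>j. word_ratio r (w j) ^ DIM('a) * inner_volume G (\<epsilon> / word_ratio r (w j)))
           sums tiling_volume (self_similar_tiling N \<Phi> U) \<epsilon>"
proof -
  note G = generator_properties[OF ifs feas, of G, unfolded gen, simplified]
  define A where "A = (\<lambda>j. word_map \<Phi> (w j) ` G)"
  have wj: "w j \<in> ifs_words N" for j using w by (auto simp: bij_betw_def)
  have pos: "0 < word_ratio r (w j)" for j
    using word_ratio_pos[OF _ wj] similarity_ifsD(1)[OF ifs] by blast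
  have T: "\<Union>(self_similar_tiling N \<Phi> U) = (\<Union>j. A j)"
  proof -
    have "ifs_words N = range w" using w by (simp add: bij_betw_def)
    thus ?thesis by (auto simp: self_similar_tiling_def gen A_def)
  qed
  have "open (A j)" for j
    unfolding A_def by (rule similarity_open_image[OF pos dist_word_map[OF ifs wj] G(1)])
  moreover have "disjoint_family A"
    unfolding disjoint_family_on_def A_def
    using disjoint_tiles[OF ifs feas G(4) wj wj] w by (auto simp: bij_betw_def inj_eq)
  moreover have "bounded (\<Union>j. A j)"
  proof (rule bounded_subset)
    show "bounded U" using feas by (simp add: feasible_open_set_def)
    show "(\<Union>j. A j) \<subseteq> U"
      using word_map_image_subset[OF feas wj] G(4) unfolding A_def by blast
  qed
  ultimately have "(\<lambda>j. inner_volume (A j) \<epsilon>) sums inner_volume (\<Union>j. A j) \<epsilon>"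
    by (rule inner_volume_disjoint_Union_sums)
  moreover have "inner_volume (A j) \<epsilon> =
      word_ratio r (w j) ^ DIM('a) * inner_volume G (\<epsilon> / word_ratio r (w j))" for j
    unfolding A_def by (rule inner_volume_similarity[OF pos dist_word_map[OF ifs wj] G(1,2)])
  ultimately show ?thesis by (simp add: tiling_volume_def T)
qed

section \<open>Residue sums over growing windows\<close>

lemma contour_integral_rectpath_bound:
  assumes cont: "continuous_on (path_image (rectpath a b)) f"
    and le: "Re a \<le> Re b" "Im a \<le> Im b"
    and K: "\<And>z. z \<in> path_image (rectpath a b) \<Longrightarrow> norm (f z) \<le> K"
  shows "norm (contour_integral (rectpath a b) f) \<le> K * (2 * (Re b - Re a) + 2 * (Im b - Im a))"
proof -
  define c d where "c = Complex (Re b) (Im a)" and "d = Complex (Re a) (Im b)"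
  have rect: "rectpath a b = linepath a c +++ linepath c b +++ linepath b d +++ linepath d a"
    by (simp add: rectpath_def c_def d_def Let_def)
  have img: "path_image (rectpath a b) =
      closed_segment a c \<union> closed_segment c b \<union> closed_segment b d \<union> closed_segment d a"
    unfolding rect by (simp add: path_image_join Un_assoc)
  have "K \<ge> 0" using K[of a] img norm_ge_zero order_trans by (metis UnI1 ends_in_segment(1))
  have *: "(f has_contour_integral contour_integral (linepath x y) f) (linepath x y) \<and>
           norm (contour_integral (linepath x y) f) \<le> K * norm (y - x)"
    if "closed_segment x y \<subseteq> path_image (rectpath a b)" for x y
  proof -
    have "(f has_contour_integral contour_integral (linepath x y) f) (linepath x y)"
      using that cont by (intro has_contour_integral_integral contour_integrable_continuous_linepath)
        (auto intro: continuous_on_subset)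
    moreover from this have "norm (contour_integral (linepath x y) f) \<le> K * norm (y - x)"
      by (rule has_contour_integral_bound_linepath) (use \<open>K \<ge> 0\<close> K that in auto)
    ultimately show ?thesis by blast
  qed
  note 1 = *[of a c] and 2 = *[of c b] and 3 = *[of b d] and 4 = *[of d a]
  let ?I = "\<lambda>x y. contour_integral (linepath x y) f"
  have "(f has_contour_integral ?I a c + (?I c b + (?I b d + ?I d a))) (rectpath a b)"
    unfolding rect using 1 2 3 4 img by (intro has_contour_integral_join valid_path_join) auto
  hence "norm (contour_integral (rectpath a b) f) = norm (?I a c + (?I c b + (?I b d + ?I d a)))"
    by (simp add: contour_integral_unique)
  also have "\<dots> \<le> norm (?I a c) + (norm (?I c b) + (norm (?I b d) + norm (?I d a)))"
    by (intro norm_triangle_mono order_refl)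
  also have "\<dots> \<le> K * norm (c - a) + (K * norm (b - c) + (K * norm (d - b) + K * norm (a - d)))"
    using 1 2 3 4 img by (intro add_mono) auto
  also have "norm (c - a) = Re b - Re a" using le by (simp add: c_def cmod_def)
  also have "norm (b - c) = Im b - Im a" using le by (simp add: c_def cmod_def)
  also have "norm (d - b) = Re b - Re a" using le by (simp add: d_def cmod_def)
  also have "norm (a - d) = Im b - Im a" using le by (simp add: d_def cmod_def)
  finally show ?thesis by (simp add: algebra_simps)
qed

text \<open>
  Suppose the singularities of \<open>E\<close> lie in a vertical strip, and \<open>E\<close> decays quadratically outside
  the strip and on the horizontal lines at the heights \<open>T n\<close>. Then the residues between two such
  lines sum to a contour integral over a rectangle. For heights of order \<open>a\<close> its perimeter is of
  order \<open>a\<close> and \<open>E\<close> is of order \<open>1 / a ^ 2\<close> on it, so the integral tends to 0.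
\<close>
lemma residue_sum_window_tendsto_0:
  fixes E :: "complex \<Rightarrow> complex" and T :: "int \<Rightarrow> real"
  assumes hol: "E holomorphic_on (- P)"
    and fin: "\<And>B. finite (P \<inter> ball 0 B)"
    and re: "\<And>\<omega>. \<omega> \<in> P \<Longrightarrow> \<bar>Re \<omega>\<bar> < A0"
    and off: "\<And>n \<omega>. n \<noteq> 0 \<Longrightarrow> \<omega> \<in> P \<Longrightarrow> Im \<omega> \<noteq> T n"
    and "0 \<le> C"
    and bd_re: "\<And>s. \<bar>Re s\<bar> \<ge> A0 \<Longrightarrow> norm (E s) \<le> C / norm s ^ 2"
    and bd_im: "\<And>n s. n \<noteq> 0 \<Longrightarrow> Im s = T n \<Longrightarrow> norm s \<ge> A0 \<Longrightarrow> norm (E s) \<le> C / norm s ^ 2"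
    and T: "\<And>n. n \<ge> 1 \<Longrightarrow> T (- n) < 0 \<and> 0 < T n" "filterlim T at_top at_top"
      "((\<lambda>n. T n / \<bar>T (- n)\<bar>) \<longlongrightarrow> 1) at_top"
  shows "(\<lambda>n. \<Sum>\<omega>\<in>{\<omega> \<in> P. T (- int n) < Im \<omega> \<and> Im \<omega> < T (int n)}. residue E \<omega>) \<longlonglongrightarrow> 0"
    (is "(\<lambda>n. ?S n) \<longlonglongrightarrow> 0")
proof -
  have inf: "filterlim (\<lambda>n. T (int n)) at_top sequentially"
    by (rule filterlim_compose[OF T(2) filterlim_int_sequentially])
  have ratio: "((\<lambda>n. T (int n) / \<bar>T (- int n)\<bar>) \<longlonglongrightarrow> 1)"
    by (rule filterlim_compose[OF T(3) filterlim_int_sequentially])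
  have r1: "eventually (\<lambda>n. 1 / 2 < T (int n) / \<bar>T (- int n)\<bar>) sequentially"
    by (rule order_tendstoD(1)[OF ratio]) simp
  have r2: "eventually (\<lambda>n. T (int n) / \<bar>T (- int n)\<bar> < 2) sequentially"
    by (rule order_tendstoD(2)[OF ratio]) simp
  have ev: "eventually (\<lambda>n. norm (?S n) \<le> 40 * C / T (int n)) sequentially"
    using eventually_ge_at_top[of 1] inf[unfolded filterlim_at_top_dense, rule_format, of "2 * \<bar>A0\<bar>"] r1 r2
  proof (eventually_elim)
    case (elim n)
    define a b where "a = T (int n)" and "b = - T (- int n)"
    have pos: "a > 0" "b > 0" using T(1)[of "int n"] elim(1) by (auto simp: a_def b_def)
    have ab: "b \<le> 2 * a" "a \<le> 2 * b" "2 * \<bar>A0\<bar> < a"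
      using elim(2-4) pos by (auto simp: a_def[symmetric] b_def field_simps)
    \<comment> \<open>The half width of the rectangle is its upper height \<open>a\<close>; the lower height is comparable.\<close>
    define u v where "u = Complex (-a) (-b)" and "v = Complex a a"
    have uv: "Re u \<le> Re v" "Im u \<le> Im v" "Re v - Re u = 2 * a" "Im v - Im u = a + b"
      using pos by (auto simp: u_def v_def)
    have img: "path_image (rectpath u v) = cbox u v - box u v"
      by (rule path_image_rectpath_cbox_minus_box[OF uv(1,2)])
    have bnd: "\<bar>Re s\<bar> = a \<or> Im s = T (int n) \<or> Im s = T (- int n)" "norm s \<ge> a / 2"
      if "s \<in> path_image (rectpath u v)" for s
    proof -
      have *: "Re s \<in> {-a, a} \<or> Im s \<in> {-b, a}"
        using that path_image_rectpath[OF uv(1,2)] by (auto simp: u_def v_def)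
      thus "\<bar>Re s\<bar> = a \<or> Im s = T (int n) \<or> Im s = T (- int n)"
        using pos by (auto simp: a_def b_def)
      show "norm s \<ge> a / 2"
        using * abs_Re_le_cmod[of s] abs_Im_le_cmod[of s] ab pos by auto
    qed
    have EK: "norm (E s) \<le> 4 * C / a ^ 2" if "s \<in> path_image (rectpath u v)" for s
    proof -
      have "norm (E s) \<le> C / norm s ^ 2"
        using bnd[OF that] bd_re[of s] bd_im[of "int n" s] bd_im[of "- int n" s] ab elim(1)
        by auto
      also have "\<dots> \<le> C / (a / 2) ^ 2"
        using bnd(2)[OF that] pos \<open>0 \<le> C\<close> by (intro divide_left_mono power_mono mult_pos_pos) auto
      finally show ?thesis by (simp add: power2_eq_square mult.commute)
    qed
    define Q where "Q = P \<inter> ball 0 (5 * a)"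
    have "finite Q" unfolding Q_def by (rule fin)
    have PQ: "\<omega> \<notin> path_image (rectpath u v)" if "\<omega> \<in> P" for \<omega>
      using bnd(1)[of \<omega>] re[OF that] off[OF _ that, of "int n"] off[OF _ that, of "- int n"]
        elim(1) ab by auto
    have cb: "cbox u v \<subseteq> ball 0 (5 * a)"
    proof
      fix s assume "s \<in> cbox u v"
      hence "\<bar>Re s\<bar> \<le> a" "\<bar>Im s\<bar> \<le> 2 * a" using ab pos by (auto simp: in_cbox_complex_iff u_def v_def)
      thus "s \<in> ball 0 (5 * a)" using cmod_le[of s] pos by auto
    qed
    have "contour_integral (rectpath u v) E =
        2 * pi * \<i> * (\<Sum>p\<in>Q. winding_number (rectpath u v) p * residue E p)"
    proof (rule Residue_theorem)
      show "E holomorphic_on ball 0 (5 * a) - Q"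
        by (rule holomorphic_on_subset[OF hol]) (auto simp: Q_def)
      show "path_image (rectpath u v) \<subseteq> ball 0 (5 * a) - Q"
        using cb PQ by (auto simp: img Q_def)
      show "\<forall>z. z \<notin> ball 0 (5 * a) \<longrightarrow> winding_number (rectpath u v) z = 0"
        using cb by (auto intro!: winding_number_rectpath_outside uv)
    qed (use \<open>finite Q\<close> in auto)
    also have "(\<Sum>p\<in>Q. winding_number (rectpath u v) p * residue E p) = ?S n"
    proof (rule sum.mono_neutral_cong_right)
      show "finite Q" by fact
      show "{\<omega> \<in> P. T (- int n) < Im \<omega> \<and> Im \<omega> < T (int n)} \<subseteq> Q"
      proof
        fix \<omega> assume *: "\<omega> \<in> {\<omega> \<in> P. T (- int n) < Im \<omega> \<and> Im \<omega> < T (int n)}"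
        hence "\<omega> \<in> cbox u v" using re[of \<omega>] ab(3)
          by (auto simp: in_cbox_complex_iff u_def v_def a_def b_def)
        with * cb show "\<omega> \<in> Q" by (auto simp: Q_def)
      qed
      show "\<forall>i\<in>Q - {\<omega> \<in> P. T (- int n) < Im \<omega> \<and> Im \<omega> < T (int n)}.
               winding_number (rectpath u v) i * residue E i = 0"
      proof
        fix \<omega> assume *: "\<omega> \<in> Q - {\<omega> \<in> P. T (- int n) < Im \<omega> \<and> Im \<omega> < T (int n)}"
        hence "\<omega> \<in> P" by (auto simp: Q_def)
        moreover have "\<omega> \<notin> box u v"
          using * by (auto simp: Q_def in_box_complex_iff u_def v_def a_def b_def)
        ultimately have "\<omega> \<notin> cbox u v" using PQ[of \<omega>] by (auto simp: img)
        thus "winding_number (rectpath u v) \<omega> * residue E \<omega> = 0"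
          using winding_number_rectpath_outside[OF uv(1,2)] by auto
      qed
      fix \<omega> assume *: "\<omega> \<in> {\<omega> \<in> P. T (- int n) < Im \<omega> \<and> Im \<omega> < T (int n)}"
      hence "\<omega> \<in> box u v" using re[of \<omega>] ab(3)
        by (auto simp: in_box_complex_iff u_def v_def a_def b_def)
      thus "winding_number (rectpath u v) \<omega> * residue E \<omega> = residue E \<omega>"
        by (simp add: winding_number_rectpath)
    qed
    finally have eq: "contour_integral (rectpath u v) E = 2 * pi * \<i> * ?S n" .
    have "continuous_on (path_image (rectpath u v)) E"
      by (rule continuous_on_subset[OF holomorphic_on_imp_continuous_on[OF hol]]) (use PQ in auto)
    hence "norm (contour_integral (rectpath u v) E) \<le> 4 * C / a ^ 2 * (2 * (2 * a) + 2 * (a + b))"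
      using contour_integral_rectpath_bound[OF _ uv(1,2) EK] uv(3,4) by simp
    also have "\<dots> \<le> 4 * C / a ^ 2 * (10 * a)"
      using ab pos \<open>0 \<le> C\<close> by (intro mult_left_mono) auto
    also have "\<dots> = 40 * C / a" using pos by (simp add: power2_eq_square)
    finally have "2 * pi * norm (?S n) \<le> 40 * C / a" by (simp add: eq norm_mult)
    moreover have "1 * norm (?S n) \<le> 2 * pi * norm (?S n)"
      using pi_ge_two by (intro mult_right_mono) auto
    ultimately show ?case by (simp add: a_def)
  qed
  moreover have "(\<lambda>n. 40 * C / T (int n)) \<longlonglongrightarrow> 0"
    by (rule real_tendsto_divide_at_top[OF tendsto_const inf])
  ultimately show ?thesis
    by (rule Lim_null_comparison)
qed

section \<open>Meromorphic continuation\<close>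

lemma nicely_meromorphic_eventually_eq_imp_eq:
  assumes "F nicely_meromorphic_on A" "G nicely_meromorphic_on A" "z \<in> A"
    and ev: "eventually (\<lambda>s. F s = G s) (at z)"
  shows "F z = G z"
proof (cases "is_pole F z")
  case True
  moreover have "is_pole F z \<longleftrightarrow> is_pole G z"
    using ev by (rule is_pole_cong) auto
  ultimately show ?thesis using assms is_pole_zero_at_nicely_mero by metis
next
  case False
  moreover have "is_pole F z \<longleftrightarrow> is_pole G z"
    using ev by (rule is_pole_cong) auto
  ultimately have "F \<midarrow>z\<rightarrow> F z" "G \<midarrow>z\<rightarrow> G z"
    using assms by (auto simp: nicely_meromorphic_on_def)
  moreover have "F \<midarrow>z\<rightarrow> G z"
    using \<open>G \<midarrow>z\<rightarrow> G z\<close> tendsto_cong[OF ev] by blast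
  ultimately show ?thesis using LIM_unique by blast
qed

text \<open>
  By the identity theorem any meromorphic extension determines the continuation: it is obtained by
  filling in the removable singularities and putting 0 at the poles.
\<close>
lemma meromorphic_continuation_eq:
  assumes mero: "F0 meromorphic_on UNIV" and an: "F0 analytic_on {s. Re s > \<sigma>}"
    and f: "\<And>s. Re s > \<sigma> \<Longrightarrow> F0 s = f s"
  shows "meromorphic_continuation f = remove_sings F0"
  unfolding meromorphic_continuation_def
proof (rule the_equality)
  have nice: "remove_sings F0 nicely_meromorphic_on UNIV"
    by (rule remove_sings_nicely_meromorphic[OF mero])
  have eq0: "remove_sings F0 s = f s" if "Re s > \<sigma>" for s
    using f[OF that] an that by (subst remove_sings_at_analytic) (auto intro: analytic_on_subset)
  show "remove_sings F0 nicely_meromorphic_on UNIV \<and>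
      (\<exists>\<sigma>. \<forall>s. \<sigma> < Re s \<longrightarrow> remove_sings F0 s = f s)"
    using nice eq0 by blast
  fix F assume F: "F nicely_meromorphic_on UNIV \<and> (\<exists>\<sigma>. \<forall>s. \<sigma> < Re s \<longrightarrow> F s = f s)"
  then obtain \<sigma>' where \<sigma>': "\<And>s. \<sigma>' < Re s \<Longrightarrow> F s = f s" by blast
  define D where "D = (\<lambda>s. F s - remove_sings F0 s)"
  have D: "D meromorphic_on UNIV"
    unfolding D_def using F nice by (auto simp: nicely_meromorphic_on_def intro!: meromorphic_intros)
  let ?S = "{s. Re s > max \<sigma> \<sigma>'}"
  have opS: "open ?S" by (rule open_halfspace_Re_gt)
  have "D s = 0" if "s \<in> ?S" for s using that eq0 \<sigma>' by (simp add: D_def)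
  hence "remove_sings D s = 0" if "s \<in> ?S" for s
  proof -
    have "eventually (\<lambda>w. w \<in> ?S) (at s)"
      using opS that by (rule eventually_at_in_open')
    hence "eventually (\<lambda>w. D w = 0) (at s)"
      by (rule eventually_mono) (use \<open>\<And>s. s \<in> ?S \<Longrightarrow> D s = 0\<close> in blast)
    thus ?thesis by (intro remove_sings_eqI tendsto_eventually)
  qed
  moreover define z where "z = complex_of_real (max \<sigma> \<sigma>' + 1)"
  moreover have "eventually (\<lambda>w. w \<in> ?S) (at z)"
    by (rule eventually_at_in_open'[OF opS]) (simp add: z_def max_def)
  ultimately have "eventually (\<lambda>w. remove_sings D w = 0) (at z)"
    by (elim eventually_mono) blast
  hence "frequently (\<lambda>w. remove_sings D w = 0) (at z)"
    by (intro eventually_frequently) auto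
  hence D0: "remove_sings D s = 0" for s
    by (rule frequently_eq_meromorphic_imp_constant[OF _ remove_sings_nicely_meromorphic[OF D]]) auto
  show "F = remove_sings F0"
  proof
    fix s
    have "isolated_singularity_at D s"
      using D meromorphic_on_isolated_singularity meromorphic_on_subset by blast
    hence "eventually (\<lambda>w. remove_sings D w = D w) (at s)"
      by (rule eventually_remove_sings_eq_at)
    hence "eventually (\<lambda>w. F w = remove_sings F0 w) (at s)"
      by (rule eventually_mono) (use D0 in \<open>simp add: D_def\<close>)
    thus "F s = remove_sings F0 s"
      using F nice by (intro nicely_meromorphic_eventually_eq_imp_eq[of F UNIV]) auto
  qed
qed

section \<open>The zeta function of a self-similar string\<close>

lemma sum_words_of_length:
  fixes h :: "nat \<Rightarrow> 'b::comm_semiring_1"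
  shows "finite {v \<in> ifs_words N. length v = m} \<and>
    (\<Sum>v\<in>{v \<in> ifs_words N. length v = m}. prod_list (map h v)) = (\<Sum>n=1..N. h n) ^ m"
proof (induction m)
  case 0
  have "{v \<in> ifs_words N. length v = 0} = {[]}" by (auto simp: ifs_words_def)
  thus ?case by simp
next
  case (Suc m)
  let ?W = "{v \<in> ifs_words N. length v = m}"
  have eq: "{v \<in> ifs_words N. length v = Suc m} = (\<lambda>(n, v). n # v) ` ({1..N} \<times> ?W)"
    by (auto simp: ifs_words_def length_Suc_conv image_iff)
  have "(\<Sum>v\<in>{v \<in> ifs_words N. length v = Suc m}. prod_list (map h v)) =
        (\<Sum>(n, v)\<in>{1..N} \<times> ?W. h n * prod_list (map h v))"
    unfolding eq by (subst sum.reindex) (auto simp: inj_on_def case_prod_unfold)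
  also have "\<dots> = (\<Sum>n=1..N. h n) * (\<Sum>v\<in>?W. prod_list (map h v))"
    by (simp add: sum_product sum.cartesian_product)
  finally show ?case using Suc by (auto simp: eq)
qed

text \<open>Summing over words length by length gives a geometric series.\<close>
lemma has_sum_words:
  fixes h :: "nat \<Rightarrow> 'b::{real_normed_field, banach}"
  assumes "(\<Sum>n=1..N. norm (h n)) < 1"
  shows "((\<lambda>v. prod_list (map h v)) has_sum (1 / (1 - (\<Sum>n=1..N. h n)))) (ifs_words N)"
    and "(\<lambda>v. norm (prod_list (map h v))) summable_on ifs_words N"
proof -
  define q where "q = (\<Sum>n=1..N. norm (h n))"
  have q: "0 \<le> q" "q < 1" using assms by (auto simp: q_def intro: sum_nonneg)
  define W where "W = (\<lambda>M. \<Union>m<M. {v \<in> ifs_words N. length v = m})"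
  have W: "finite (W M)" "W M \<subseteq> ifs_words N" for M
    using sum_words_of_length[where N = N and h = h] by (auto simp: W_def)
  have sumW: "(\<Sum>v\<in>W M. prod_list (map k v)) = (\<Sum>m<M. (\<Sum>n=1..N. k n) ^ m)"
    for M and k :: "nat \<Rightarrow> 'c::comm_semiring_1"
    unfolding W_def using sum_words_of_length[where N = N and h = k]
    by (subst sum.UNION_disjoint) auto
  have nrm: "norm (prod_list (map h v)) = prod_list (map (\<lambda>n. norm (h n)) v)" for v
    by (induction v) (auto simp: norm_mult)
  show summ: "(\<lambda>v. norm (prod_list (map h v))) summable_on ifs_words N"
  proof (rule nonneg_bdd_above_summable_on)
    show "bdd_above (sum (\<lambda>v. norm (prod_list (map h v))) ` {F. F \<subseteq> ifs_words N \<and> finite F})"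
    proof (rule bdd_aboveI2)
      fix F assume F: "F \<in> {F. F \<subseteq> ifs_words N \<and> finite F}"
      then obtain M where M: "\<forall>v\<in>F. length v < M"
        using finite_nat_set_iff_bounded[of "length ` F"] by auto
      hence "F \<subseteq> W M" using F by (auto simp: W_def)
      hence "sum (\<lambda>v. norm (prod_list (map h v))) F \<le> sum (\<lambda>v. norm (prod_list (map h v))) (W M)"
        using W by (intro sum_mono2) auto
      also have "\<dots> = (\<Sum>m<M. q ^ m)" by (simp add: nrm sumW q_def)
      also have "\<dots> \<le> (\<Sum>m. q ^ m)"
        using q by (intro sum_le_suminf summable_geometric) auto
      finally show "sum (\<lambda>v. norm (prod_list (map h v))) F \<le> (\<Sum>m. q ^ m)" .
    qed
  qed simp
  then obtain S where S: "((\<lambda>v. prod_list (map h v)) has_sum S) (ifs_words N)"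
    using abs_summable_summable[OF summ] by (auto simp: summable_on_def)
  have "filterlim W (finite_subsets_at_top (ifs_words N)) sequentially"
    unfolding filterlim_finite_subsets_at_top
  proof (intro allI impI)
    fix X assume X: "finite X \<and> X \<subseteq> ifs_words N"
    then obtain M where M: "\<forall>v\<in>X. length v < M"
      using finite_nat_set_iff_bounded[of "length ` X"] by auto
    have "X \<subseteq> W m" if "M \<le> m" for m
      using M X that by (force simp: W_def)
    thus "\<forall>\<^sub>F m in sequentially. finite (W m) \<and> X \<subseteq> W m \<and> W m \<subseteq> ifs_words N"
      using W by (auto simp: eventually_at_top_linorder)
  qed
  hence "(\<lambda>M. \<Sum>v\<in>W M. prod_list (map h v)) \<longlonglongrightarrow> S"
    using S unfolding has_sum_def by (rule filterlim_compose[rotated])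
  moreover have "(\<lambda>M. \<Sum>v\<in>W M. prod_list (map h v)) \<longlonglongrightarrow> 1 / (1 - (\<Sum>n=1..N. h n))"
  proof -
    have "norm (\<Sum>n=1..N. h n) < 1" using assms sum_norm_le[of "{1..N}" h "\<lambda>n. norm (h n)"] by simp
    from geometric_sums[OF this] show ?thesis by (simp add: sumW sums_def)
  qed
  ultimately have "S = 1 / (1 - (\<Sum>n=1..N. h n))" by (rule LIMSEQ_unique)
  with S show "((\<lambda>v. prod_list (map h v)) has_sum (1 / (1 - (\<Sum>n=1..N. h n)))) (ifs_words N)"
    by simp
qed

text \<open>
  A self-similar string: the ratios of all words in the letters \<open>1, \<dots>, N\<close>, enumerated by \<open>L\<close>.
  The exponent \<open>d\<close> exceeds the abscissa of convergence.
\<close>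
locale self_similar_string =
  fixes N :: nat and r :: "nat \<Rightarrow> real" and d :: nat and w :: "nat \<Rightarrow> nat list" and L :: "nat \<Rightarrow> real"
  assumes N: "1 \<le> N"
    and r01: "n \<in> {1..N} \<Longrightarrow> 0 < r n" "n \<in> {1..N} \<Longrightarrow> r n < 1"
    and power_less_one: "(\<Sum>n=1..N. r n ^ d) < 1"
    and w: "bij_betw w UNIV (ifs_words N)"
    and L: "L = (\<lambda>j. word_ratio r (w j))"
begin

text \<open>The function \<open>p(s)\<close> of the Moran equation \<open>p(s) = 1\<close>; the zeta function is \<open>1 / (1 - p(s))\<close>.\<close>
definition ratio_sum :: "complex \<Rightarrow> complex" where
  "ratio_sum s = (\<Sum>n=1..N. complex_of_real (r n) powr s)"

text \<open>The poles of the zeta function, as the roots of the Moran equation.\<close>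
definition zeta_poles :: "complex set" where
  "zeta_poles = {s. ratio_sum s = 1}"

lemma L_pos: "0 < L j"
  using word_ratio_pos[of N r "w j"] r01(1) w by (auto simp: L bij_betw_def)

lemma norm_L_powr: "norm (complex_of_real (L j) powr s) = L j powr Re s"
  using L_pos[of j] by (simp add: norm_powr_real_powr)

lemma word_ratio_powr:
  assumes "v \<in> ifs_words N"
  shows "complex_of_real (word_ratio r v) powr s = prod_list (map (\<lambda>n. complex_of_real (r n) powr s) v)"
  using assms
proof (induction v)
  case (Cons n v)
  hence v: "n \<in> {1..N}" "v \<in> ifs_words N" by (auto simp: ifs_words_Cons)
  hence "0 < r n" "0 < word_ratio r v" using r01(1) word_ratio_pos[of N r v] by auto
  hence "complex_of_real (r n * word_ratio r v) powr s =
      complex_of_real (r n) powr s * complex_of_real (word_ratio r v) powr s"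
    by (simp add: powr_times_real)
  thus ?case using Cons.IH[OF v(2)] by (simp add: word_ratio_def)
qed (simp add: word_ratio_def)

lemma sum_norm_less_one:
  assumes "Re s \<ge> d"
  shows "(\<Sum>n=1..N. norm (complex_of_real (r n) powr s)) < 1"
proof -
  have "(\<Sum>n=1..N. norm (complex_of_real (r n) powr s)) \<le> (\<Sum>n=1..N. r n ^ d)"
  proof (rule sum_mono)
    fix n assume "n \<in> {1..N}"
    note * = r01[OF this]
    have "norm (complex_of_real (r n) powr s) = r n powr Re s"
      using * by (simp add: norm_powr_real_powr)
    also have "\<dots> \<le> r n powr d" using * assms by (intro powr_mono') auto
    finally show "norm (complex_of_real (r n) powr s) \<le> r n ^ d" using * by (simp add: powr_realpow)
  qed
  with power_less_one show ?thesis by simp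
qed

lemma norm_ratio_sum_less_one: "Re s \<ge> d \<Longrightarrow> norm (ratio_sum s) < 1"
  unfolding ratio_sum_def
  using sum_norm_less_one[of s] sum_norm_le[of "{1..N}" "\<lambda>n. complex_of_real (r n) powr s" "\<lambda>n. norm (complex_of_real (r n) powr s)"]
  by simp

lemma L_powr_sums:
  assumes "Re s \<ge> d"
  shows "(\<lambda>j. complex_of_real (L j) powr s) sums (1 / (1 - ratio_sum s))"
proof -
  have wj: "w j \<in> ifs_words N" for j using w by (auto simp: bij_betw_def)
  have "((\<lambda>j. prod_list (map (\<lambda>n. complex_of_real (r n) powr s) (w j))) has_sum (1 / (1 - ratio_sum s))) UNIV"
    unfolding ratio_sum_def
    by (rule has_sum_reindex_bij_betw[OF w, THEN iffD2], rule has_sum_words(1))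
       (rule sum_norm_less_one[OF assms])
  thus ?thesis by (intro has_sum_imp_sums) (simp add: L word_ratio_powr[OF wj])
qed

lemma summable_L_power: "summable (\<lambda>j. L j ^ d)"
proof -
  have wj: "w j \<in> ifs_words N" for j using w by (auto simp: bij_betw_def)
  have "(\<lambda>j. norm (prod_list (map (\<lambda>n. complex_of_real (r n) powr d) (w j)))) summable_on UNIV"
    by (rule summable_on_reindex_bij_betw[OF w, THEN iffD2], rule has_sum_words(2))
       (use sum_norm_less_one[of "of_nat d"] in simp)
  hence "summable (\<lambda>j. norm (complex_of_real (L j) powr d))"
    by (intro summable_on_imp_summable) (simp add: L word_ratio_powr[OF wj])
  thus ?thesis using L_pos by (simp add: norm_L_powr powr_realpow)
qed

lemma finite_L_greater:
  assumes "0 < c"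
  shows "finite {j. L j > c}"
proof -
  have "(\<lambda>j. L j ^ d) \<longlonglongrightarrow> 0" by (rule summable_LIMSEQ_zero[OF summable_L_power])
  hence "eventually (\<lambda>j. L j ^ d < c ^ d) sequentially"
    using assms by (intro order_tendstoD) auto
  then obtain M where M: "\<And>j. j \<ge> M \<Longrightarrow> L j ^ d < c ^ d" by (auto simp: eventually_at_top_linorder)
  have "L j < c" if "j \<ge> M" for j
    using power_less_imp_less_base[OF M[OF that]] assms by simp
  hence "{j. L j > c} \<subseteq> {..<M}" by (force simp: not_less[symmetric])
  thus ?thesis by (rule finite_subset) simp
qed

lemma ratio_sum_holomorphic: "ratio_sum holomorphic_on A"
  unfolding ratio_sum_def[abs_def] using r01(1)
  by (intro holomorphic_intros) force

text \<open>Far to the left the smallest ratio dominates.\<close>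
lemma ratio_sum_large_left: "\<exists>A\<ge>0. \<forall>s. Re s \<le> - A \<longrightarrow> 2 \<le> norm (ratio_sum s)"
proof -
  define \<rho> where "\<rho> = Min (r ` {1..N})"
  define M where "M = {n \<in> {1..N}. r n = \<rho>}"
  have "\<rho> \<in> r ` {1..N}" unfolding \<rho>_def using N by (intro Min_in) auto
  then obtain n0 where n0: "n0 \<in> {1..N}" "r n0 = \<rho>" by auto
  hence \<rho>: "0 < \<rho>" "\<rho> < 1" using r01 by auto
  have \<rho>_le: "\<rho> \<le> r n" if "n \<in> {1..N}" for n unfolding \<rho>_def using that by (intro Min_le) auto
  have M: "finite M" "M \<noteq> {}" "M \<subseteq> {1..N}" using n0 by (auto simp: M_def)
  have lim: "((\<lambda>\<sigma>. c powr \<sigma>) \<longlongrightarrow> 0) at_bot" if "c > 1" for c :: real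
  proof -
    have "filterlim (\<lambda>\<sigma>. ln c * \<sigma>) at_bot at_bot"
      using that by (intro filterlim_tendsto_pos_mult_at_bot[OF tendsto_const _ filterlim_ident]) auto
    thus ?thesis
      using that by (auto simp: powr_def mult.commute intro: filterlim_compose[OF exp_at_bot])
  qed
  have "((\<lambda>\<sigma>. \<Sum>n\<in>{1..N} - M. (r n / \<rho>) powr \<sigma>) \<longlongrightarrow> (\<Sum>n\<in>{1..N} - M. 0)) at_bot"
  proof (intro tendsto_sum lim)
    fix n assume "n \<in> {1..N} - M"
    hence "\<rho> < r n" using \<rho>_le[of n] by (auto simp: M_def)
    thus "1 < r n / \<rho>" using \<rho> by simp
  qed
  hence "eventually (\<lambda>\<sigma>. (\<Sum>n\<in>{1..N} - M. (r n / \<rho>) powr \<sigma>) < 1 / 2) at_bot"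
    by (intro order_tendstoD) auto
  moreover have "eventually (\<lambda>\<sigma>. (1 / \<rho>) powr \<sigma> < 1 / 4) at_bot"
    using \<rho> by (intro order_tendstoD(2)[OF lim]) auto
  ultimately have "eventually (\<lambda>\<sigma>. (\<Sum>n\<in>{1..N} - M. (r n / \<rho>) powr \<sigma>) < 1 / 2 \<and>
      (1 / \<rho>) powr \<sigma> < 1 / 4) at_bot" by (rule eventually_conj)
  then obtain B where B: "\<And>\<sigma>. \<sigma> \<le> B \<Longrightarrow> (\<Sum>n\<in>{1..N} - M. (r n / \<rho>) powr \<sigma>) < 1 / 2 \<and>
      (1 / \<rho>) powr \<sigma> < 1 / 4"
    unfolding eventually_at_bot_linorder by blast
  have "2 \<le> norm (ratio_sum s)" if "Re s \<le> - max 0 (- B)" for s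
  proof -
    define \<sigma> where "\<sigma> = Re s"
    have \<sigma>: "(\<Sum>n\<in>{1..N} - M. (r n / \<rho>) powr \<sigma>) < 1 / 2" "(1 / \<rho>) powr \<sigma> < 1 / 4"
      using B[of \<sigma>] that by (auto simp: \<sigma>_def)
    have \<rho>4: "\<rho> powr \<sigma> > 4"
      using \<sigma>(2) \<rho> by (simp add: powr_divide field_simps)
    have 1: "(\<Sum>n\<in>M. complex_of_real (r n) powr s) = of_nat (card M) * complex_of_real \<rho> powr s"
      by (simp add: M_def)
    have "ratio_sum s = (\<Sum>n\<in>{1..N} - M. complex_of_real (r n) powr s) +
        (\<Sum>n\<in>M. complex_of_real (r n) powr s)"
      unfolding ratio_sum_def using M by (intro sum.subset_diff) auto
    hence "norm (ratio_sum s) \<ge> norm (\<Sum>n\<in>M. complex_of_real (r n) powr s) -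
        norm (\<Sum>n\<in>{1..N} - M. complex_of_real (r n) powr s)"
      using norm_diff_ineq by (simp add: add.commute)
    moreover have "norm (\<Sum>n\<in>M. complex_of_real (r n) powr s) \<ge> 1 * \<rho> powr \<sigma>"
    proof -
      have "1 \<le> real (card M)" using M by (simp add: Suc_le_eq card_gt_0_iff)
      hence "1 * \<rho> powr \<sigma> \<le> real (card M) * \<rho> powr \<sigma>" by (intro mult_right_mono) auto
      thus ?thesis using \<rho> by (simp add: 1 norm_mult norm_powr_real_powr \<sigma>_def)
    qed
    moreover have "norm (\<Sum>n\<in>{1..N} - M. complex_of_real (r n) powr s) \<le> \<rho> powr \<sigma> * (1 / 2)"
    proof -
      have "norm (\<Sum>n\<in>{1..N} - M. complex_of_real (r n) powr s) \<le>
          (\<Sum>n\<in>{1..N} - M. \<rho> powr \<sigma> * (r n / \<rho>) powr \<sigma>)"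
      proof (rule sum_norm_le)
        fix n assume "n \<in> {1..N} - M"
        hence "0 < r n" using r01 by auto
        thus "norm (complex_of_real (r n) powr s) \<le> \<rho> powr \<sigma> * (r n / \<rho>) powr \<sigma>"
          using \<rho> by (simp add: norm_powr_real_powr powr_divide \<sigma>_def)
      qed
      also have "\<dots> = \<rho> powr \<sigma> * (\<Sum>n\<in>{1..N} - M. (r n / \<rho>) powr \<sigma>)"
        by (simp add: sum_distrib_left)
      also have "\<dots> \<le> \<rho> powr \<sigma> * (1 / 2)" using \<sigma>(1) by (intro mult_left_mono) auto
      finally show ?thesis .
    qed
    ultimately show ?thesis using \<rho>4 by linarith
  qed
  thus ?thesis by (intro exI[of _ "max 0 (- B)"]) auto
qed

lemma finite_zeta_poles: "finite (zeta_poles \<inter> cball 0 B)"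
proof -
  obtain A where A: "\<And>s. Re s \<le> - A \<Longrightarrow> 2 \<le> norm (ratio_sum s)" using ratio_sum_large_left by blast
  have "\<not> (\<lambda>s. ratio_sum s - 1) constant_on UNIV"
  proof
    assume "(\<lambda>s. ratio_sum s - 1) constant_on UNIV"
    then obtain c where "\<And>s. ratio_sum s - 1 = c" by (auto simp: constant_on_def)
    hence "ratio_sum (of_nat d) = ratio_sum (of_real (- A))" by (metis diff_add_cancel)
    moreover have "norm (ratio_sum (of_nat d)) < 1" by (rule norm_ratio_sum_less_one) simp
    moreover have "2 \<le> norm (ratio_sum (of_real (- A)))" by (rule A) simp
    ultimately show False by simp
  qed
  hence "finite {s \<in> cball 0 B. ratio_sum s - 1 = 0}"
    by (intro holomorphic_compact_finite_zeros[of _ UNIV] holomorphic_intros ratio_sum_holomorphic) auto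
  thus ?thesis by (rule finite_subset[rotated]) (auto simp: zeta_poles_def)
qed

lemma zeta_poles_isolated: "eventually (\<lambda>s. s \<notin> zeta_poles) (at z)"
proof -
  have "finite (zeta_poles \<inter> cball 0 (norm z + 1) - {z})" using finite_zeta_poles by auto
  hence "open (ball 0 (norm z + 1) - (zeta_poles \<inter> cball 0 (norm z + 1) - {z}))"
    by (intro open_Diff finite_imp_closed) auto
  hence "eventually (\<lambda>s. s \<in> ball 0 (norm z + 1) - (zeta_poles \<inter> cball 0 (norm z + 1) - {z}) - {z}) (at z)"
    by (rule eventually_at_in_open) auto
  thus ?thesis by (rule eventually_mono) auto
qed

lemma zeta_meromorphic: "(\<lambda>s. 1 / (1 - ratio_sum s)) meromorphic_on UNIV"
  using ratio_sum_holomorphic[of UNIV]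
  by (intro meromorphic_intros analytic_on_imp_meromorphic_on) (auto simp: analytic_on_open)

lemma zeta_holomorphic: "(\<lambda>s. 1 / (1 - ratio_sum s)) holomorphic_on - zeta_poles"
  by (intro holomorphic_intros ratio_sum_holomorphic) (auto simp: zeta_poles_def)

lemma open_compl_zeta_poles: "open (- zeta_poles)"
proof -
  have "continuous_on UNIV ratio_sum"
    using ratio_sum_holomorphic by (rule holomorphic_on_imp_continuous_on)
  hence "closed {s. ratio_sum s = 1}" by (intro closed_Collect_eq continuous_on_const)
  thus ?thesis by (simp add: zeta_poles_def open_Compl)
qed

lemma Re_zeta_poles_less: "s \<in> zeta_poles \<Longrightarrow> Re s < d"
  using norm_ratio_sum_less_one[of s] by (force simp: zeta_poles_def)

lemma string_zeta_eq: "string_zeta L = remove_sings (\<lambda>s. 1 / (1 - ratio_sum s))"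
  unfolding string_zeta_def
proof (rule meromorphic_continuation_eq[OF zeta_meromorphic, where \<sigma> = d])
  show "(\<lambda>s. 1 / (1 - ratio_sum s)) analytic_on {s. real d < Re s}"
    using Re_zeta_poles_less open_halfspace_Re_gt[of d]
    by (subst analytic_on_open) (auto intro!: holomorphic_on_subset[OF zeta_holomorphic] dest: less_asym)
  show "1 / (1 - ratio_sum s) = (\<Sum>j. complex_of_real (L j) powr s)" if "real d < Re s" for s
    using L_powr_sums[of s] that by (simp add: sums_iff)
qed

lemma string_zeta_off_poles: "s \<notin> zeta_poles \<Longrightarrow> string_zeta L s = 1 / (1 - ratio_sum s)"
  unfolding string_zeta_eq
  using zeta_holomorphic open_compl_zeta_poles
  by (intro remove_sings_at_analytic) (auto intro: holomorphic_on_imp_analytic_at)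

lemma is_pole_string_zeta_iff: "is_pole (string_zeta L) s \<longleftrightarrow> s \<in> zeta_poles"
proof
  assume s: "is_pole (string_zeta L) s"
  show "s \<in> zeta_poles"
  proof (rule ccontr)
    assume "s \<notin> zeta_poles"
    have "string_zeta L holomorphic_on - zeta_poles"
      by (rule holomorphic_transform[OF zeta_holomorphic]) (simp add: string_zeta_off_poles)
    hence "\<not> is_pole (string_zeta L) s"
      using open_compl_zeta_poles \<open>s \<notin> zeta_poles\<close> by (intro not_is_pole_holomorphic) auto
    with s show False by blast
  qed
next
  assume s: "s \<in> zeta_poles"
  have ev: "eventually (\<lambda>z. z \<notin> zeta_poles) (at s)" by (rule zeta_poles_isolated)
  have "isCont (\<lambda>z. 1 - ratio_sum z) s"
    using ratio_sum_holomorphic[of UNIV]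
    by (intro continuous_intros analytic_at_imp_isCont) (auto intro: holomorphic_on_imp_analytic_at)
  hence "(\<lambda>z. 1 - ratio_sum z) \<midarrow>s\<rightarrow> 0" using s by (auto simp: isCont_def zeta_poles_def)
  hence "isolated_zero (\<lambda>z. 1 - ratio_sum z) s"
    unfolding isolated_zero_def using eventually_mono[OF ev] by (auto simp: zeta_poles_def)
  hence "is_pole (\<lambda>z. inverse (1 - ratio_sum z)) s" by (simp add: is_pole_inverse_iff)
  moreover have "eventually (\<lambda>z. string_zeta L z = inverse (1 - ratio_sum z)) (at s)"
    using ev by (rule eventually_mono) (simp add: string_zeta_off_poles field_simps)
  ultimately show "is_pole (string_zeta L) s" by (subst is_pole_cong) auto
qed

text \<open>A pole on a horizontal line makes the zeta function unbounded on that line.\<close>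
lemma bounded_line_no_zeta_poles:
  assumes "\<And>\<alpha>. norm (string_zeta L (Complex \<alpha> t)) \<le> c" "\<omega> \<in> zeta_poles"
  shows "Im \<omega> \<noteq> t"
proof
  assume t: "Im \<omega> = t"
  have "is_pole (string_zeta L) \<omega>" using assms(2) by (simp add: is_pole_string_zeta_iff)
  hence "filterlim (\<lambda>s. norm (string_zeta L s)) at_top (at \<omega>)"
    unfolding is_pole_def by (rule filterlim_compose[OF filterlim_norm_at_top])
  hence "eventually (\<lambda>s. c < norm (string_zeta L s)) (at \<omega>)"
    by (simp add: filterlim_at_top_dense)
  then obtain e where e: "e > 0" "\<And>s. s \<noteq> \<omega> \<Longrightarrow> dist s \<omega> < e \<Longrightarrow> c < norm (string_zeta L s)"
    by (auto simp: eventually_at)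
  have "c < norm (string_zeta L (\<omega> + of_real (e / 2)))"
    using e(1) by (intro e(2)) (auto simp: dist_norm)
  moreover have "\<omega> + of_real (e / 2) = Complex (Re \<omega> + e / 2) t"
    using t by (simp add: complex_eq_iff)
  ultimately show False using assms(1)[of "Re \<omega> + e / 2"] by simp
qed

end

section \<open>The residues of the tubular zeta function\<close>

text \<open>The coefficient of \<open>1 / s\<close> at infinity is the sum of the residues.\<close>
lemma sum_simple_poles_decay:
  fixes a :: "nat \<Rightarrow> complex"
  assumes "(\<Sum>k\<le>d. a k) = 0"
  shows "\<exists>C\<ge>0. \<forall>s. norm s \<ge> 2 * real d + 1 \<longrightarrow> norm (\<Sum>k\<le>d. a k / (s - of_nat k)) \<le> C / norm s ^ 2"
proof (intro exI[of _ "\<Sum>k\<le>d. 2 * real k * norm (a k)"] conjI allI impI)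
  fix s :: complex assume s: "norm s \<ge> 2 * real d + 1"
  have "(\<Sum>k\<le>d. a k / (s - of_nat k)) = (\<Sum>k\<le>d. a k / (s - of_nat k)) - (\<Sum>k\<le>d. a k) / s"
    using assms by simp
  also have "\<dots> = (\<Sum>k\<le>d. a k / (s - of_nat k) - a k / s)"
    by (simp add: sum_subtractf sum_divide_distrib)
  also have "norm \<dots> \<le> (\<Sum>k\<le>d. 2 * real k * norm (a k) / norm s ^ 2)"
  proof (rule sum_norm_le)
    fix k assume k: "k \<in> {..d}"
    have ge: "norm (s - of_nat k) \<ge> norm s / 2"
      using norm_triangle_ineq2[of s "of_nat k"] s k by auto
    have "s \<noteq> 0" "s \<noteq> of_nat k" using s k by auto
    hence "a k / (s - of_nat k) - a k / s = of_nat k * a k / (s * (s - of_nat k))"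
      by (simp add: field_simps)
    hence "norm (a k / (s - of_nat k) - a k / s) = real k * norm (a k) / (norm s * norm (s - of_nat k))"
      by (simp add: norm_divide norm_mult)
    also have "\<dots> \<le> real k * norm (a k) / (norm s * (norm s / 2))"
      using ge \<open>s \<noteq> 0\<close> \<open>s \<noteq> of_nat k\<close> by (intro divide_left_mono mult_left_mono mult_pos_pos) auto
    finally show "norm (a k / (s - of_nat k) - a k / s) \<le> 2 * real k * norm (a k) / norm s ^ 2"
      by (simp add: power2_eq_square mult_ac)
  qed
  finally show "norm (\<Sum>k\<le>d. a k / (s - of_nat k)) \<le> (\<Sum>k\<le>d. 2 * real k * norm (a k)) / norm s ^ 2"
    by (simp add: sum_divide_distrib)
qed (auto intro: sum_nonneg)

lemma residue_sum_simple_poles: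
  fixes m :: "nat \<Rightarrow> complex \<Rightarrow> complex"
  assumes hol: "\<And>k. k \<in> K \<Longrightarrow> m k holomorphic_on UNIV" and "finite K"
  shows "residue (\<lambda>s. \<Sum>k\<in>K. m k s / (s - of_nat k)) \<omega> = (\<Sum>k\<in>K. if \<omega> = of_nat k then m k \<omega> else 0)"
  using assms(2,1)
proof (induction K rule: finite_induct)
  case (insert k K)
  define S where "S = - (of_nat ` insert k K - {\<omega>})"
  have "finite (of_nat ` insert k K - {\<omega>})" using insert(1) by simp
  hence "open S" unfolding S_def by (intro open_Compl finite_imp_closed)
  moreover have "\<omega> \<in> S" by (simp add: S_def)
  ultimately have S: "open S" "\<omega> \<in> S" .
  have ne: "s \<noteq> of_nat k'" if "s \<in> S - {\<omega>}" "k' \<in> insert k K" for s k' using that by (auto simp: S_def)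
  have h: "(\<lambda>s. m k' s / (s - of_nat k')) holomorphic_on S - {\<omega>}" if "k' \<in> insert k K" for k'
    using ne[OF _ that] insert.prems[OF that] by (intro holomorphic_intros) (auto intro: holomorphic_on_subset)
  have "residue (\<lambda>s. m k s / (s - of_nat k) + (\<Sum>k\<in>K. m k s / (s - of_nat k))) \<omega> =
      residue (\<lambda>s. m k s / (s - of_nat k)) \<omega> + residue (\<lambda>s. \<Sum>k\<in>K. m k s / (s - of_nat k)) \<omega>"
    by (rule residue_add[OF S]) (use h in \<open>auto intro!: holomorphic_on_sum\<close>)
  moreover have "residue (\<lambda>s. m k s / (s - of_nat k)) \<omega> = (if \<omega> = of_nat k then m k \<omega> else 0)"
  proof (cases "\<omega> = of_nat k")
    case True
    thus ?thesis using residue_simple[of UNIV \<omega> "m k"] insert.prems by simp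
  next
    case False
    have "(\<lambda>s. m k s / (s - of_nat k)) holomorphic_on - {of_nat k}"
      using insert.prems by (intro holomorphic_intros) (auto intro: holomorphic_on_subset)
    from residue_holo[OF _ _ this] False show ?thesis by (simp add: open_Compl)
  qed
  ultimately show ?case using insert by simp
qed (simp add: residue_const)

context self_similar_string
begin

text \<open>
  The part of the zeta function that comes from the lengths \<open>L j \<le> 1 / x\<close>, times \<open>x powr s\<close>,
  is bounded wherever the zeta function is under control.
\<close>
lemma zeta_remainder_bounded:
  assumes x: "1 < x" and J: "J = {j. 1 < L j * x}" and A: "0 \<le> A"
    and left: "\<And>s. Re s \<le> - A \<Longrightarrow> 2 \<le> norm (ratio_sum s)" and "0 \<le> c"
  shows "\<exists>B\<ge>0. \<forall>s. Re s \<ge> d \<or> Re s \<le> - A \<or> norm (1 / (1 - ratio_sum s)) \<le> c \<longrightarrow>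
    norm ((1 / (1 - ratio_sum s) - (\<Sum>j\<in>J. complex_of_real (L j) powr s)) * complex_of_real x powr s) \<le> B"
proof -
  have finJ: "finite J"
    using finite_L_greater[of "1 / x"] x by (simp add: J field_simps)
  have nx: "norm (complex_of_real x powr s) = x powr Re s" for s using x by (simp add: norm_powr_real_powr)
  have nLx: "norm (complex_of_real (L j) powr s) * norm (complex_of_real x powr s) = (L j * x) powr Re s" for j s
    using L_pos[of j] x by (simp add: nx norm_L_powr powr_mult)
  define R where "R = (\<lambda>s. 1 / (1 - ratio_sum s) - (\<Sum>j\<in>J. complex_of_real (L j) powr s))"
  define B1 where "B1 = (\<Sum>j. L j ^ d * x ^ d)"
  define B3 where "B3 = c * x ^ d + (\<Sum>j\<in>J. (L j * x) ^ d)"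
  have summ: "summable (\<lambda>j. L j ^ d * x ^ d)" by (intro summable_mult2 summable_L_power)
  \<comment> \<open>On the right, \<open>R\<close> is the series over the complement of \<open>J\<close>, where \<open>L j * x \<le> 1\<close>.\<close>
  have b1: "norm (R s * complex_of_real x powr s) \<le> B1" if "Re s \<ge> d" for s
  proof -
    have "(\<lambda>j. (complex_of_real (L j) powr s - (if j \<in> J then complex_of_real (L j) powr s else 0)) *
        complex_of_real x powr s) sums (R s * complex_of_real x powr s)"
      unfolding R_def by (intro sums_mult2 sums_diff L_powr_sums that sums_If_finite_set finJ)
    hence "R s * complex_of_real x powr s =
        (\<Sum>j. (complex_of_real (L j) powr s - (if j \<in> J then complex_of_real (L j) powr s else 0)) *
        complex_of_real x powr s)" by (simp add: sums_iff)
    also have "norm \<dots> \<le> B1"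
      unfolding B1_def
    proof (rule norm_suminf_le[OF _ summ])
      fix j
      show "norm ((complex_of_real (L j) powr s - (if j \<in> J then complex_of_real (L j) powr s else 0)) *
          complex_of_real x powr s) \<le> L j ^ d * x ^ d"
      proof (cases "j \<in> J")
        case False
        have "(L j * x) powr Re s \<le> (L j * x) powr d"
          using False that L_pos[of j] x by (intro powr_mono') (auto simp: J)
        also have "\<dots> = L j ^ d * x ^ d" using L_pos[of j] x by (simp add: powr_realpow power_mult_distrib)
        finally show ?thesis using False by (simp add: norm_mult nLx)
      qed (use L_pos[of j] x in simp)
    qed
    finally show ?thesis .
  qed
  have bJ: "norm (R s * complex_of_real x powr s) \<le>
      norm (1 / (1 - ratio_sum s)) * x powr Re s + (\<Sum>j\<in>J. (L j * x) powr Re s)" for s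
  proof -
    have "norm (R s * complex_of_real x powr s) \<le> norm (1 / (1 - ratio_sum s) * complex_of_real x powr s) +
        norm (\<Sum>j\<in>J. complex_of_real (L j) powr s * complex_of_real x powr s)"
      unfolding R_def left_diff_distrib sum_distrib_right by (rule norm_triangle_ineq4)
    moreover have "norm (\<Sum>j\<in>J. complex_of_real (L j) powr s * complex_of_real x powr s) \<le>
        (\<Sum>j\<in>J. (L j * x) powr Re s)"
      by (intro sum_norm_le) (simp add: norm_mult nLx)
    ultimately show ?thesis by (simp add: norm_mult norm_divide nx)
  qed
  \<comment> \<open>On the left, \<open>ratio_sum\<close> is large and all powers of \<open>x\<close> and \<open>L j * x\<close> are at most 1.\<close>
  have b2: "norm (R s * complex_of_real x powr s) \<le> 1 + card J" if "Re s \<le> - A" for s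
  proof -
    have "norm (1 - ratio_sum s) \<ge> 1"
      using left[OF that] norm_triangle_ineq2[of "ratio_sum s" 1] by (simp add: norm_minus_commute)
    hence "norm (1 / (1 - ratio_sum s)) * x powr Re s \<le> 1 * x powr 0"
      using that A x by (intro mult_mono powr_mono) (auto simp: norm_divide divide_le_eq_1)
    moreover have "(\<Sum>j\<in>J. (L j * x) powr Re s) \<le> (\<Sum>j\<in>J. (L j * x) powr 0)"
      using that A by (intro sum_mono powr_mono) (auto simp: J)
    moreover have "(\<Sum>j\<in>J. (L j * x) powr 0) = card J"
      using L_pos x by (simp add: less_imp_neq[THEN not_sym])
    ultimately show ?thesis using bJ[of s] x by simp
  qed
  have b3: "norm (R s * complex_of_real x powr s) \<le> B3"
    if "Re s \<le> d" "norm (1 / (1 - ratio_sum s)) \<le> c" for s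
  proof -
    have "norm (1 / (1 - ratio_sum s)) * x powr Re s \<le> c * x powr d"
      using that x \<open>0 \<le> c\<close> by (intro mult_mono powr_mono) auto
    moreover have "(\<Sum>j\<in>J. (L j * x) powr Re s) \<le> (\<Sum>j\<in>J. (L j * x) powr d)"
      using that by (intro sum_mono powr_mono) (auto simp: J)
    moreover have "(\<Sum>j\<in>J. (L j * x) powr d) = (\<Sum>j\<in>J. (L j * x) ^ d)"
      using L_pos x by (intro sum.cong refl powr_realpow mult_pos_pos) auto
    ultimately show ?thesis using bJ[of s] x by (simp add: B3_def powr_realpow)
  qed
  show ?thesis
  proof (intro exI[of _ "max B1 (max (1 + card J) B3)"] conjI allI impI)
    fix s assume "Re s \<ge> d \<or> Re s \<le> - A \<or> norm (1 / (1 - ratio_sum s)) \<le> c"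
    hence "norm (R s * complex_of_real x powr s) \<le> max B1 (max (1 + card J) B3)"
      using b1[of s] b2[of s] b3[of s] by (cases "Re s \<ge> d") auto
    thus "norm ((1 / (1 - ratio_sum s) - (\<Sum>j\<in>J. complex_of_real (L j) powr s)) * complex_of_real x powr s)
        \<le> max B1 (max (1 + card J) B3)" by (simp add: R_def)
  qed auto
qed

text \<open>The complex dimensions of a tiling in dimension \<open>d\<close>, where the tubular zeta function may be singular.\<close>
definition singularities :: "complex set" where
  "singularities = zeta_poles \<union> of_nat ` {..d}"

lemma finite_singularities: "finite (singularities \<inter> ball 0 B)"
proof (rule finite_subset)
  show "singularities \<inter> ball 0 B \<subseteq> (zeta_poles \<inter> cball 0 B) \<union> of_nat ` {..d}"
    by (auto simp: singularities_def)
qed (use finite_zeta_poles in auto)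

lemma abs_Re_singularities_less:
  assumes "0 \<le> A" "\<And>s. Re s \<le> - A \<Longrightarrow> 2 \<le> norm (ratio_sum s)" "\<omega> \<in> singularities"
  shows "\<bar>Re \<omega>\<bar> < A + 2 * real d + 1"
proof (cases "\<omega> \<in> zeta_poles")
  case True
  have "Re \<omega> > - A" using assms(2)[of \<omega>] True by (force simp: zeta_poles_def)
  thus ?thesis using Re_zeta_poles_less[OF True] assms(1) by auto
qed (use assms(1,3) in \<open>auto simp: singularities_def\<close>)

lemma finite_singularities_window: "finite {\<omega> \<in> singularities. a < Im \<omega> \<and> Im \<omega> < b}"
proof -
  obtain A where A: "0 \<le> A" "\<And>s. Re s \<le> - A \<Longrightarrow> 2 \<le> norm (ratio_sum s)"
    using ratio_sum_large_left by blast
  have "\<omega> \<in> ball 0 (A + 2 * real d + 1 + \<bar>a\<bar> + \<bar>b\<bar>)" if "\<omega> \<in> singularities" "a < Im \<omega>" "Im \<omega> < b" for \<omega>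
    using abs_Re_singularities_less[OF A that(1)] cmod_le[of \<omega>] that(2,3) by auto
  hence "{\<omega> \<in> singularities. a < Im \<omega> \<and> Im \<omega> < b} \<subseteq>
      singularities \<inter> ball 0 (A + 2 * real d + 1 + \<bar>a\<bar> + \<bar>b\<bar>)" by blast
  thus ?thesis by (rule finite_subset) (rule finite_singularities)
qed

lemma residue_sum_remainder_tendsto_0:
  fixes a :: "nat \<Rightarrow> complex"
  assumes x: "1 < x" and J: "J = {j. 1 < L j * x}" and a: "(\<Sum>k\<le>d. a k) = 0"
    and T: "languid_heights (string_zeta L) T"
  shows "(\<lambda>n. \<Sum>\<omega>\<in>{\<omega> \<in> singularities. T (- int n) < Im \<omega> \<and> Im \<omega> < T (int n)}.
      residue (\<lambda>s. (1 / (1 - ratio_sum s) - (\<Sum>j\<in>J. complex_of_real (L j) powr s)) *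
        complex_of_real x powr s * (\<Sum>k\<le>d. a k / (s - of_nat k))) \<omega>) \<longlonglongrightarrow> 0"
proof -
  define R where "R = (\<lambda>s. (1 / (1 - ratio_sum s) - (\<Sum>j\<in>J. complex_of_real (L j) powr s)) *
        complex_of_real x powr s)"
  define H where "H = (\<lambda>s. \<Sum>k\<le>d. a k / (s - of_nat k))"
  obtain A where A: "0 \<le> A" "\<And>s. Re s \<le> - A \<Longrightarrow> 2 \<le> norm (ratio_sum s)"
    using ratio_sum_large_left by blast
  obtain c where c: "0 < c" "\<And>n \<alpha>. norm (string_zeta L (Complex \<alpha> (T n))) \<le> c"
    using T unfolding languid_heights_def by blast
  obtain B where B: "0 \<le> B" "\<And>s. Re s \<ge> d \<or> Re s \<le> - A \<or> norm (1 / (1 - ratio_sum s)) \<le> c \<Longrightarrow> norm (R s) \<le> B"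
    unfolding R_def using zeta_remainder_bounded[OF x J A less_imp_le[OF c(1)]] by blast
  obtain C where C: "0 \<le> C" "\<And>s. norm s \<ge> 2 * real d + 1 \<Longrightarrow> norm (H s) \<le> C / norm s ^ 2"
    unfolding H_def using sum_simple_poles_decay[OF a] by blast
  have T0: "T n \<noteq> 0" if "n \<noteq> 0" for n
  proof (cases "n \<ge> 1")
    case False
    hence "- n \<ge> 1" using that by simp
    thus ?thesis using T unfolding languid_heights_def by (metis less_irrefl minus_minus)
  qed (use T in \<open>auto simp: languid_heights_def\<close>)
  \<comment> \<open>The lines avoid the real axis, hence \<open>0, \<dots>, d\<close>, and by languidity the poles of the zeta function.\<close>
  have off: "Im \<omega> \<noteq> T n" if "n \<noteq> 0" "\<omega> \<in> singularities" for n \<omega>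
    using that T0[OF that(1)] bounded_line_no_zeta_poles[OF c(2), of \<omega> n] by (auto simp: singularities_def)
  define A0 where "A0 = A + 2 * real d + 1"
  have RH: "norm (R s * H s) \<le> B * C / norm s ^ 2" if "norm (R s) \<le> B" "norm s \<ge> A0" for s
  proof -
    have "norm (R s * H s) \<le> B * (C / norm s ^ 2)"
      using that C(2)[of s] A(1) B(1) unfolding norm_mult by (intro mult_mono) (auto simp: A0_def)
    thus ?thesis by simp
  qed
  have "(\<lambda>n. \<Sum>\<omega>\<in>{\<omega> \<in> singularities. T (- int n) < Im \<omega> \<and> Im \<omega> < T (int n)}.
      residue (\<lambda>s. R s * H s) \<omega>) \<longlonglongrightarrow> 0"
  proof (rule residue_sum_window_tendsto_0)
    show "(\<lambda>s. R s * H s) holomorphic_on - singularities"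
      unfolding R_def H_def using L_pos x
      by (intro holomorphic_intros holomorphic_on_subset[OF zeta_holomorphic])
         (auto simp: singularities_def less_imp_neq[THEN not_sym])
    show "finite (singularities \<inter> ball 0 B)" for B by (rule finite_singularities)
    show "\<bar>Re \<omega>\<bar> < A0" if "\<omega> \<in> singularities" for \<omega>
      using abs_Re_singularities_less[OF A that] by (simp add: A0_def)
    show "Im \<omega> \<noteq> T n" if "n \<noteq> 0" "\<omega> \<in> singularities" for n \<omega> using off[OF that] .
    show "0 \<le> B * C" using B C by simp
    show "norm (R s * H s) \<le> B * C / norm s ^ 2" if "\<bar>Re s\<bar> \<ge> A0" for s
    proof (rule RH)
      show "norm (R s) \<le> B" using that A(1) by (intro B(2)) (auto simp: A0_def)
      show "norm s \<ge> A0" using that abs_Re_le_cmod[of s] by linarith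
    qed
    show "norm (R s * H s) \<le> B * C / norm s ^ 2" if "n \<noteq> 0" "Im s = T n" "norm s \<ge> A0" for n s
    proof (rule RH)
      have "s \<notin> zeta_poles" using off[OF that(1), of s] that(2) by (auto simp: singularities_def)
      hence "norm (1 / (1 - ratio_sum s)) \<le> c"
        using c(2)[of "Re s" n] that(2) string_zeta_off_poles[of s] by (metis complex_surj)
      thus "norm (R s) \<le> B" by (intro B(2)) auto
    qed (use that in simp)
  qed (use T in \<open>auto simp: languid_heights_def\<close>)
  thus ?thesis by (simp add: R_def H_def)
qed

lemma tiling_dimensions_eq: "tiling_dimensions d L = singularities"
  by (simp add: tiling_dimensions_def singularities_def string_dimensions_def is_pole_string_zeta_iff)

end

text \<open>
  The volume term has the same shape as the term for \<open>k = d\<close>, so it is absorbed in the coefficient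
  there.
\<close>
lemma steiner_terms_eq:
  fixes e :: "nat \<Rightarrow> real"
  assumes "0 < g"
  shows "(\<Sum>k\<le>d. complex_of_real g powr (s - of_nat k) / (s - of_nat k) * complex_of_real (e k))
      - complex_of_real g powr (s - of_nat d) / (s - of_nat d) * complex_of_real \<mu> =
    complex_of_real g powr s *
      (\<Sum>k\<le>d. complex_of_real ((e k - (if k = d then \<mu> else 0)) / g ^ k) / (s - of_nat k))"
proof -
  have p: "complex_of_real g powr (s - of_nat k) = complex_of_real g powr s / of_real (g ^ k)" for k
    using assms by (simp add: powr_diff powr_nat')
  have "complex_of_real g powr s *
      (\<Sum>k\<le>d. complex_of_real ((e k - (if k = d then \<mu> else 0)) / g ^ k) / (s - of_nat k)) =
    (\<Sum>k\<le>d. complex_of_real g powr (s - of_nat k) / (s - of_nat k) * complex_of_real (e k) -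
      (if k = d then complex_of_real g powr (s - of_nat d) / (s - of_nat d) * complex_of_real \<mu> else 0))"
    unfolding sum_distrib_left p
    by (intro sum.cong refl) (auto simp: diff_divide_distrib right_diff_distrib)
  thus ?thesis by (simp add: sum_subtractf)
qed

context self_similar_string
begin

text \<open>
  The tubular zeta function, with the finitely many tiles whose inradius exceeds \<open>\<epsilon>\<close> split off.
  For all other tiles the extended coefficients are those at the inradius of the generator. Here \<open>x\<close> is the inradius of the generator divided by \<open>\<epsilon>\<close>.
\<close>
lemma tubular_zeta_eq:
  fixes G :: "'a::euclidean_space set" and \<kappa> :: "nat \<Rightarrow> real \<Rightarrow> real" and \<epsilon> :: real
  defines "g \<equiv> inradius G" and "\<mu> \<equiv> measure lebesgue G"
  defines "cf \<equiv> \<lambda>\<delta> k. complex_of_real ((\<kappa> k \<delta> - (if k = d then \<mu> else 0)) / g ^ k)"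
  defines "x \<equiv> g / \<epsilon>"
  defines "J \<equiv> {j. 1 < L j * x}"
  assumes d: "DIM('a) = d" and \<epsilon>: "0 < \<epsilon>" "\<epsilon> < g"
  shows "tubular_zeta G \<kappa> L \<epsilon> = remove_sings (\<lambda>s. complex_of_real (\<epsilon> ^ d) *
    ((1 / (1 - ratio_sum s) - (\<Sum>j\<in>J. complex_of_real (L j) powr s)) * complex_of_real x powr s *
       (\<Sum>k\<le>d. cf g k / (s - of_nat k)) +
     (\<Sum>k\<le>d. (\<Sum>j\<in>J. cf (\<epsilon> / L j) k * complex_of_real (L j * x) powr s) / (s - of_nat k))))"
    (is "_ = remove_sings ?F")
proof -
  have g: "0 < g" using \<epsilon> by simp
  have x: "1 < x" using \<epsilon> by (simp add: x_def)
  have finJ: "finite J" using finite_L_greater[of "1 / x"] x by (simp add: J_def field_simps)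
  have Lx: "L j * x \<noteq> 0" for j using L_pos[of j] x by simp
  show ?thesis
    unfolding tubular_zeta_def
  proof (rule meromorphic_continuation_eq[where \<sigma> = d])
    have P: "(\<lambda>s. complex_of_real y powr s) meromorphic_on UNIV" if "y \<noteq> 0" for y
      by (intro analytic_on_imp_meromorphic_on) (use that in \<open>auto simp: analytic_on_open intro!: holomorphic_intros\<close>)
    have "ratio_sum meromorphic_on UNIV"
      using ratio_sum_holomorphic[of UNIV]
      by (intro analytic_on_imp_meromorphic_on) (simp add: analytic_on_open)
    thus "?F meromorphic_on UNIV"
      using x Lx L_pos by (intro meromorphic_intros P) (auto simp: less_imp_neq[THEN not_sym])
    show "?F analytic_on {s. real d < Re s}"
    proof -
      have sub: "{s. real d < Re s} \<subseteq> - zeta_poles"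
        using Re_zeta_poles_less by (auto dest: less_asym)
      note zh = holomorphic_on_subset[OF zeta_holomorphic sub]
      show ?thesis
        unfolding analytic_on_open[OF open_halfspace_Re_gt] by (intro holomorphic_intros zh) auto
    qed
  next
    fix s assume s: "real d < Re s"
    define h where "h = (\<lambda>\<delta>. \<Sum>k\<le>d. cf \<delta> k / (s - of_nat k))"
    define Q where "Q = (\<lambda>\<delta>. complex_of_real g powr s * h \<delta>)"
    have inner: "(\<Sum>k\<le>DIM('a). complex_of_real (inradius G) powr (s - of_nat k) / (s - of_nat k) *
             complex_of_real (steiner_ext G \<kappa> k (inverse (L j) * \<epsilon>)))
         - complex_of_real (inradius G) powr (s - of_nat DIM('a)) / (s - of_nat DIM('a)) *
             complex_of_real (measure lebesgue G) = Q (if j \<in> J then \<epsilon> / L j else g)" for j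
    proof -
      have "steiner_ext G \<kappa> k (inverse (L j) * \<epsilon>) = \<kappa> k (if j \<in> J then \<epsilon> / L j else g)" for k
        using L_pos[of j] \<epsilon> by (auto simp: steiner_ext_def J_def x_def g_def[symmetric] field_simps)
      thus ?thesis
        unfolding d g_def[symmetric] \<mu>_def[symmetric] Q_def h_def cf_def
        by (simp only: steiner_terms_eq[OF g])
    qed
    have "(\<lambda>j. complex_of_real (L j) powr s * Q g +
        (if j \<in> J then complex_of_real (L j) powr s * (Q (\<epsilon> / L j) - Q g) else 0)) sums
        (1 / (1 - ratio_sum s) * Q g + (\<Sum>j\<in>J. complex_of_real (L j) powr s * (Q (\<epsilon> / L j) - Q g)))"
      using s by (intro sums_add sums_mult2 L_powr_sums sums_If_finite_set finJ) auto
    moreover have "complex_of_real (L j) powr s * Q g +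
        (if j \<in> J then complex_of_real (L j) powr s * (Q (\<epsilon> / L j) - Q g) else 0) =
        complex_of_real (L j) powr s * Q (if j \<in> J then \<epsilon> / L j else g)" for j
      by (simp add: algebra_simps)
    ultimately have sm: "(\<Sum>j. complex_of_real (L j) powr s * Q (if j \<in> J then \<epsilon> / L j else g)) =
        1 / (1 - ratio_sum s) * Q g + (\<Sum>j\<in>J. complex_of_real (L j) powr s * (Q (\<epsilon> / L j) - Q g))"
      by (simp add: sums_iff)
    have regroup: "1 / (1 - ratio_sum s) * Q g + (\<Sum>j\<in>J. complex_of_real (L j) powr s * (Q (\<epsilon> / L j) - Q g)) =
        (1 / (1 - ratio_sum s) - (\<Sum>j\<in>J. complex_of_real (L j) powr s)) * Q g +
        (\<Sum>j\<in>J. complex_of_real (L j) powr s * Q (\<epsilon> / L j))"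
      by (simp add: algebra_simps sum_subtractf sum_distrib_left)
    have \<epsilon>s: "complex_of_real \<epsilon> powr (of_nat d - s) * complex_of_real g powr s =
        complex_of_real (\<epsilon> ^ d) * complex_of_real x powr s"
    proof -
      have "complex_of_real \<epsilon> powr (of_nat d - s) = complex_of_real (\<epsilon> ^ d) / complex_of_real \<epsilon> powr s"
        using \<epsilon> by (simp add: powr_diff powr_nat')
      moreover have "complex_of_real g powr s = complex_of_real x powr s * complex_of_real \<epsilon> powr s"
      proof -
        have "complex_of_real g = complex_of_real x * complex_of_real \<epsilon>" using \<epsilon> by (simp add: x_def)
        thus ?thesis using powr_times_real[of "complex_of_real x" "complex_of_real \<epsilon>" s] x \<epsilon> by simp
      qed
      ultimately show ?thesis using \<epsilon> by simp
    qed
    have swap: "(\<Sum>k\<le>d. (\<Sum>j\<in>J. cf (\<epsilon> / L j) k * complex_of_real (L j * x) powr s) / (s - of_nat k)) =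
        complex_of_real x powr s *
        (\<Sum>j\<in>J. complex_of_real (L j) powr s * h (\<epsilon> / L j))"
    proof -
      have *: "complex_of_real (L j * x) powr s = complex_of_real (L j) powr s * complex_of_real x powr s" for j
        using L_pos[of j] x by (simp add: powr_times_real)
      show ?thesis
        unfolding * h_def sum_divide_distrib sum_distrib_left
        by (subst sum.swap) (simp add: mult_ac)
    qed
    define Rs where "Rs = 1 / (1 - ratio_sum s) - (\<Sum>j\<in>J. complex_of_real (L j) powr s)"
    define S where "S = (\<Sum>j\<in>J. complex_of_real (L j) powr s * h (\<epsilon> / L j))"
    have total: "(\<Sum>j. complex_of_real (L j) powr s * Q (if j \<in> J then \<epsilon> / L j else g)) =
        complex_of_real g powr s * (Rs * h g + S)"
    proof -
      have "(\<Sum>j\<in>J. complex_of_real (L j) powr s * Q (\<epsilon> / L j)) = complex_of_real g powr s * S"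
        by (simp add: Q_def S_def sum_distrib_left mult_ac)
      thus ?thesis unfolding sm regroup Rs_def[symmetric] by (simp add: Q_def algebra_simps)
    qed
    have "complex_of_real (\<epsilon> ^ d) * (Rs * complex_of_real x powr s * h g + complex_of_real x powr s * S) =
        (complex_of_real \<epsilon> powr (of_nat d - s) * complex_of_real g powr s) * (Rs * h g + S)"
      unfolding \<epsilon>s by (simp add: algebra_simps)
    also have "\<dots> = complex_of_real \<epsilon> powr (of_nat d - s) *
        (\<Sum>j. complex_of_real (L j) powr s * Q (if j \<in> J then \<epsilon> / L j else g))"
      unfolding total by (simp only: mult.assoc)
    also have "h g = (\<Sum>k\<le>d. cf g k / (s - of_nat k))" by (simp add: h_def)
    finally show "?F s = complex_of_real \<epsilon> powr (of_nat DIM('a) - s) *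
     (\<Sum>j. complex_of_real (L j) powr s *
        ((\<Sum>k\<le>DIM('a). complex_of_real (inradius G) powr (s - of_nat k) / (s - of_nat k) *
             complex_of_real (steiner_ext G \<kappa> k (inverse (L j) * \<epsilon>)))
         - complex_of_real (inradius G) powr (s - of_nat DIM('a)) / (s - of_nat DIM('a)) *
             complex_of_real (measure lebesgue G)))"
      unfolding inner unfolding swap Rs_def S_def d .
  qed
qed

end

section \<open>The tube formula\<close>

theorem theorem5p7:
  fixes N :: nat and r :: "nat \<Rightarrow> real" and \<Phi> :: "nat \<Rightarrow> 'a::euclidean_space \<Rightarrow> 'a"
    and U G :: "'a set" and w :: "nat \<Rightarrow> nat list" and L :: "nat \<Rightarrow> real"
    and \<kappa> :: "nat \<Rightarrow> real \<Rightarrow> real" and T :: "int \<Rightarrow> real" and \<epsilon> :: real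
  assumes "similarity_ifs N r \<Phi>"
    and "feasible_open_set N \<Phi> U"
    and "nontriviality_condition N \<Phi>"
    and "generators N \<Phi> U = {G}"
    and "word_enumeration N r w"
    and "L = (\<lambda>j. word_ratio r (w j))"
    and "steiner_like G \<kappa>"
    and "languid_heights (string_zeta L) T"
    and "0 < \<epsilon>" and "\<epsilon> < inradius G"
  shows "convergent (truncated_residue_sum T (tiling_dimensions DIM('a) L) (tubular_zeta G \<kappa> L \<epsilon>)) \<and>
         complex_of_real (tiling_volume (self_similar_tiling N \<Phi> U) \<epsilon>) =
           lim (truncated_residue_sum T (tiling_dimensions DIM('a) L) (tubular_zeta G \<kappa> L \<epsilon>))
           + complex_of_real (measure lebesgue G) * string_zeta L (of_nat DIM('a))"
proof -
  define d where "d = DIM('a)"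
  define g where "g = inradius G"
  define \<mu> where "\<mu> = measure lebesgue G"
  define V where "V = inner_volume G"
  note ifs = assms(1) and feas = assms(2)
  note G = generator_properties[OF ifs feas, of G, unfolded assms(4), simplified]
  have w: "bij_betw w UNIV (ifs_words N)" using assms(5) by (simp add: word_enumeration_def)
  interpret self_similar_string N r d w L
  proof
    show "1 \<le> N" using ifs by (simp add: similarity_ifs_def)
    show "(\<Sum>n=1..N. r n ^ d) < 1"
      unfolding d_def by (rule sum_ratio_power_less_one[OF ifs feas G(1,3,4)])
  qed (use similarity_ifsD[OF ifs] w assms(6) in auto)
  have \<epsilon>: "0 < \<epsilon>" "\<epsilon> < g" using assms(9,10) by (auto simp: g_def)
  define x where "x = g / \<epsilon>"
  have x: "1 < x" and g: "0 < g" using \<epsilon> by (auto simp: x_def)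
  define J where "J = {j. 1 < L j * x}"
  have finJ: "finite J" using finite_L_greater[of "1 / x"] x by (simp add: J_def field_simps)
  define cf where "cf = (\<lambda>\<delta> k. complex_of_real ((\<kappa> k \<delta> - (if k = d then \<mu> else 0)) / g ^ k))"

  have steiner: "(\<Sum>k\<le>d. (\<kappa> k \<delta> - (if k = d then \<mu> else 0)) * \<delta> ^ (d - k)) = V \<delta> - \<mu>"
    if "0 < \<delta>" "\<delta> \<le> g" for \<delta>
  proof -
    have "V \<delta> = (\<Sum>k\<le>d. \<kappa> k \<delta> * \<delta> ^ (d - k))"
      using assms(7) that unfolding steiner_like_def V_def d_def g_def by auto
    moreover have "(\<Sum>k\<le>d. (\<kappa> k \<delta> - (if k = d then \<mu> else 0)) * \<delta> ^ (d - k)) =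
        (\<Sum>k\<le>d. \<kappa> k \<delta> * \<delta> ^ (d - k) - (if k = d then \<mu> else 0))"
      by (intro sum.cong) (auto simp: left_diff_distrib)
    ultimately show ?thesis by (simp add: sum_subtractf)
  qed
  have V_large: "V \<delta> = \<mu>" if "g \<le> \<delta>" for \<delta>
    using inner_volume_ge_inradius[OF G(1,2), of \<delta>] that by (simp add: V_def \<mu>_def g_def)
  \<comment> \<open>At the inradius the Steiner-like representation gives the full volume of the generator.\<close>
  have a0: "(\<Sum>k\<le>d. cf g k) = 0"
  proof -
    have "g ^ d * (\<Sum>k\<le>d. (\<kappa> k g - (if k = d then \<mu> else 0)) / g ^ k) =
        (\<Sum>k\<le>d. (\<kappa> k g - (if k = d then \<mu> else 0)) * g ^ (d - k))"
      unfolding sum_distrib_left using g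
      by (intro sum.cong) (auto simp: power_diff)
    also have "\<dots> = 0" using steiner[of g] V_large[of g] g by simp
    finally have "(\<Sum>k\<le>d. (\<kappa> k g - (if k = d then \<mu> else 0)) / g ^ k) = 0" using g by simp
    hence "complex_of_real (\<Sum>k\<le>d. (\<kappa> k g - (if k = d then \<mu> else 0)) / g ^ k) = 0" by simp
    thus ?thesis unfolding cf_def of_real_sum .
  qed

  \<comment> \<open>Up to the factor \<open>\<epsilon> ^ d\<close>, \<open>E\<close> carries the poles of the zeta function, and its residue sums vanish in the limit;\<close>
  \<comment> \<open>\<open>S\<close> comes from the tiles in \<open>J\<close> and has only the simple poles \<open>0, \<dots>, d\<close>.\<close>
  define E where "E = (\<lambda>s. (1 / (1 - ratio_sum s) - (\<Sum>j\<in>J. complex_of_real (L j) powr s)) *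
      complex_of_real x powr s * (\<Sum>k\<le>d. cf g k / (s - of_nat k)))"
  define m where "m = (\<lambda>k s. \<Sum>j\<in>J. cf (\<epsilon> / L j) k * complex_of_real (L j * x) powr s)"
  define S where "S = (\<lambda>s. \<Sum>k\<le>d. m k s / (s - of_nat k))"
  have tub: "tubular_zeta G \<kappa> L \<epsilon> = remove_sings (\<lambda>s. complex_of_real (\<epsilon> ^ d) * (E s + S s))"
    unfolding E_def S_def m_def cf_def J_def x_def \<mu>_def g_def
    by (rule tubular_zeta_eq) (use \<epsilon> in \<open>auto simp: d_def g_def\<close>)
  have Lx: "L j * x \<noteq> 0" for j using L_pos[of j] x by simp
  have m_hol: "m k holomorphic_on A" for k A
    unfolding m_def by (intro holomorphic_intros)
  have E_hol: "E holomorphic_on - singularities"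
    unfolding E_def using L_pos x
    by (intro holomorphic_intros holomorphic_on_subset[OF zeta_holomorphic])
       (auto simp: singularities_def less_imp_neq[THEN not_sym])
  have S_hol: "S holomorphic_on - singularities"
    unfolding S_def by (intro holomorphic_intros m_hol) (auto simp: singularities_def)
  have res: "residue (tubular_zeta G \<kappa> L \<epsilon>) \<omega> =
      complex_of_real (\<epsilon> ^ d) * (residue E \<omega> + residue S \<omega>)" for \<omega>
  proof -
    let ?B = "ball 0 (norm \<omega> + 1)"
    define Y where "Y = ?B - (singularities \<inter> ?B - {\<omega>})"
    have "finite (singularities \<inter> ?B - {\<omega>})" using finite_singularities by auto
    hence Y: "open Y" "\<omega> \<in> Y" unfolding Y_def by (auto intro!: open_Diff finite_imp_closed)
    have sub: "Y - {\<omega>} \<subseteq> - singularities" by (auto simp: Y_def)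
    note hol = holomorphic_on_subset[OF E_hol sub] holomorphic_on_subset[OF S_hol sub]
    have ES: "(\<lambda>s. E s + S s) holomorphic_on Y - {\<omega>}" by (intro holomorphic_intros hol)
    have "isolated_singularity_at (\<lambda>s. complex_of_real (\<epsilon> ^ d) * (E s + S s)) \<omega>"
      using ES Y by (intro isolated_singularity_at_holomorphic[of _ Y] holomorphic_intros hol) auto
    thus ?thesis
      unfolding tub using residue_lmul[OF Y ES] residue_add[OF Y hol] by simp
  qed

  define W where "W = (\<lambda>n. {\<omega> \<in> singularities. T (- int n) < Im \<omega> \<and> Im \<omega> < T (int n)})"
  have limE: "(\<lambda>n. \<Sum>\<omega>\<in>W n. residue E \<omega>) \<longlonglongrightarrow> 0"
    unfolding W_def E_def by (rule residue_sum_remainder_tendsto_0[OF x J_def a0 assms(8)])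
  define Z where "Z = (\<Sum>k\<le>d. m k (of_nat k))"
  \<comment> \<open>Every window contains the real axis, hence \<open>0, \<dots>, d\<close>, so the sums are constant for \<open>n \<ge> 1\<close>.\<close>
  have limS: "(\<lambda>n. \<Sum>\<omega>\<in>W n. residue S \<omega>) \<longlonglongrightarrow> Z"
  proof (rule tendsto_eventually)
    show "eventually (\<lambda>n. (\<Sum>\<omega>\<in>W n. residue S \<omega>) = Z) sequentially"
      using eventually_ge_at_top[of 1]
    proof eventually_elim
      case (elim n)
      have Tn: "T (- int n) < 0" "0 < T (int n)"
        using assms(8) elim unfolding languid_heights_def by auto
      have fin: "finite (W n)" unfolding W_def by (rule finite_singularities_window)
      have "(\<Sum>\<omega>\<in>W n. residue S \<omega>) = (\<Sum>\<omega>\<in>W n. \<Sum>k\<le>d. if \<omega> = of_nat k then m k \<omega> else 0)"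
        unfolding S_def by (intro sum.cong refl residue_sum_simple_poles m_hol) auto
      also have "\<dots> = (\<Sum>k\<le>d. \<Sum>\<omega>\<in>W n. if \<omega> = of_nat k then m k (of_nat k) else 0)"
        by (subst sum.swap) (auto intro!: sum.cong)
      also have "\<dots> = Z"
        unfolding Z_def using fin Tn by (intro sum.cong refl) (auto simp: W_def singularities_def)
      finally show ?case .
    qed
  qed
  have trunc: "truncated_residue_sum T (tiling_dimensions DIM('a) L) (tubular_zeta G \<kappa> L \<epsilon>) =
      (\<lambda>n. complex_of_real (\<epsilon> ^ d) * ((\<Sum>\<omega>\<in>W n. residue E \<omega>) + (\<Sum>\<omega>\<in>W n. residue S \<omega>)))"
    unfolding truncated_residue_sum_def d_def[symmetric] tiling_dimensions_eq res W_def
    by (simp only: sum_distrib_left sum.distrib distrib_left)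
  have lim: "truncated_residue_sum T (tiling_dimensions DIM('a) L) (tubular_zeta G \<kappa> L \<epsilon>)
      \<longlonglongrightarrow> complex_of_real (\<epsilon> ^ d) * Z"
    unfolding trunc using tendsto_mult_left[OF tendsto_add[OF limE limS]] by simp

  \<comment> \<open>The residues of \<open>S\<close> reassemble the Steiner-like representation at \<open>\<epsilon> / L j\<close>.\<close>
  have Z: "complex_of_real (\<epsilon> ^ d) * Z = complex_of_real (\<Sum>j\<in>J. L j ^ d * (V (\<epsilon> / L j) - \<mu>))"
  proof -
    have tile: "\<epsilon> ^ d * (\<Sum>k\<le>d. (\<kappa> k (\<epsilon> / L j) - (if k = d then \<mu> else 0)) / g ^ k * (L j * x) ^ k) =
        L j ^ d * (V (\<epsilon> / L j) - \<mu>)" if "j \<in> J" for j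
    proof -
      have Lj: "0 < L j" by (rule L_pos)
      have "\<epsilon> / L j \<le> g" using that Lj \<epsilon> by (simp add: J_def x_def field_simps)
      hence V: "V (\<epsilon> / L j) - \<mu> = (\<Sum>k\<le>d. (\<kappa> k (\<epsilon> / L j) - (if k = d then \<mu> else 0)) * (\<epsilon> / L j) ^ (d - k))"
        using steiner[of "\<epsilon> / L j"] Lj \<epsilon> by simp
      have "\<epsilon> ^ d * (c / g ^ k * (L j * x) ^ k) = L j ^ d * (c * (\<epsilon> / L j) ^ (d - k))"
        if "k \<le> d" for c k
      proof -
        have "\<epsilon> ^ d = \<epsilon> ^ k * \<epsilon> ^ (d - k)" "L j ^ d = L j ^ k * L j ^ (d - k)"
          using that by (simp_all flip: power_add)
        thus ?thesis using \<epsilon> g Lj by (simp add: x_def power_divide power_mult_distrib field_simps)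
      qed
      thus ?thesis unfolding V sum_distrib_left by (intro sum.cong refl) auto
    qed
    have "complex_of_real (L j * x) powr of_nat k = complex_of_real ((L j * x) ^ k)" for j k
      unfolding of_real_power using Lx[of j] by (intro powr_nat') simp
    hence "m k (of_nat k) = complex_of_real
        (\<Sum>j\<in>J. (\<kappa> k (\<epsilon> / L j) - (if k = d then \<mu> else 0)) / g ^ k * (L j * x) ^ k)" for k
      unfolding m_def cf_def by (simp only: of_real_sum of_real_mult)
    hence "complex_of_real (\<epsilon> ^ d) * Z = complex_of_real (\<epsilon> ^ d * (\<Sum>k\<le>d. \<Sum>j\<in>J.
        (\<kappa> k (\<epsilon> / L j) - (if k = d then \<mu> else 0)) / g ^ k * (L j * x) ^ k))"
      unfolding Z_def by simp
    also have "\<epsilon> ^ d * (\<Sum>k\<le>d. \<Sum>j\<in>J. (\<kappa> k (\<epsilon> / L j) - (if k = d then \<mu> else 0)) / g ^ k * (L j * x) ^ k) =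
        (\<Sum>j\<in>J. \<epsilon> ^ d * (\<Sum>k\<le>d. (\<kappa> k (\<epsilon> / L j) - (if k = d then \<mu> else 0)) / g ^ k * (L j * x) ^ k))"
      unfolding sum_distrib_left by (rule sum.swap)
    also have "\<dots> = (\<Sum>j\<in>J. L j ^ d * (V (\<epsilon> / L j) - \<mu>))" by (intro sum.cong refl tile)
    finally show ?thesis .
  qed

  have vol: "tiling_volume (self_similar_tiling N \<Phi> U) \<epsilon> =
      (\<Sum>j\<in>J. L j ^ d * (V (\<epsilon> / L j) - \<mu>)) + \<mu> * (\<Sum>j. L j ^ d)"
  proof -
    have "(\<lambda>j. (if j \<in> J then L j ^ d * (V (\<epsilon> / L j) - \<mu>) else 0) + \<mu> * L j ^ d) sums
        ((\<Sum>j\<in>J. L j ^ d * (V (\<epsilon> / L j) - \<mu>)) + \<mu> * (\<Sum>j. L j ^ d))"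
      by (intro sums_add sums_If_finite_set finJ sums_mult summable_sums summable_L_power)
    moreover have "(if j \<in> J then L j ^ d * (V (\<epsilon> / L j) - \<mu>) else 0) + \<mu> * L j ^ d =
        L j ^ d * V (\<epsilon> / L j)" for j
    proof (cases "j \<in> J")
      case False
      hence "g \<le> \<epsilon> / L j" using L_pos[of j] \<epsilon> by (simp add: J_def x_def field_simps)
      thus ?thesis using False V_large by simp
    qed (simp add: algebra_simps)
    ultimately show ?thesis
      using tiling_volume_sums[OF ifs feas assms(4) w, of \<epsilon>]
      by (simp add: V_def d_def assms(6) sums_iff)
  qed
  have zeta_d: "string_zeta L (of_nat d) = complex_of_real (\<Sum>j. L j ^ d)"
  proof -
    have "of_nat d \<notin> zeta_poles" using Re_zeta_poles_less by force
    hence "(\<lambda>j. complex_of_real (L j) powr of_nat d) sums string_zeta L (of_nat d)"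
      using L_powr_sums[of "of_nat d"] by (simp add: string_zeta_off_poles)
    moreover have "complex_of_real (L j) powr of_nat d = complex_of_real (L j ^ d)" for j
      using L_pos[of j] by (simp add: powr_nat')
    moreover have "(\<lambda>j. complex_of_real (L j ^ d)) sums complex_of_real (\<Sum>j. L j ^ d)"
      by (intro sums_of_real summable_sums summable_L_power)
    ultimately show ?thesis using sums_unique2 by force
  qed
  show ?thesis
    using lim limI[OF lim] vol zeta_d Z by (auto simp: convergent_def d_def \<mu>_def)
qed

end
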